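(* Let $p$ be an odd prime and $r\ge 1$. Let $h'$ be the map which sends a pair of standard $\boldsymbol{p}$-Young tableaux of the same shape $\lambda\in W^r_0\cup W^r_1\cup\dots\cup W^r_{r-1}$ to an element of $SG_r$, defined as follows. (i) If $\lambda=\lambda(k,k')\in W^r_s$ with $1\le s\le r-1$, and $P_i,P_j$ are the standard $\boldsymbol{p}$-Young tableaux of shape $\lambda$ with integer numbers $i,j$ ($1\le i,j\le p^{s-1}(p-1)$), then $$h'(P_i,P_j)=\tau^{-(i-1)}\,(g^{p})^{p^{r-s-1}}\,\tau^{*}\,\tau^{j-1}\,\tau^{l\,p^{s-1}(p-1)},$$ where $\tau^{*}=\tau^{p^{r-1}(p-1)/2}$ and $l=l(\lambda)$. (ii) If $\lambda=\lambda(p^{r-1}(p-1),k')\in W^r_0$, the unique pair $(P,P)$ of standard $\boldsymbol{p}$-Young tableaux of shape $\lambda$ is sent to $\tau^{j(k')}$. Then $$h':\ \bigcup_{\lambda\in W^r_0\cup W^r_1\cup\dots\cup W^r_{r-1}}\mathrm{SYT}_p(\lambda)\times \mathrm{SYT}_p(\lambda)\longrightarrow SG_r$$ is a bijection.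
   Context: **Groups.** $G_r=\{\tau^ig^j : 1\le i\le p^{r-1}(p-1),\ 1\le j\le p^r\}\cong \mathbb{Z}_{p^r}\rtimes\mathbb{Z}_{p^r}^*$, where $g$ has order $p^r$, $\tau$ has order $p^{r-1}(p-1)$, and $\tau^{-1}g\tau=g^{t}$ for a fixed generator $t$ of the cyclic group $\mathbb{Z}_{p^r}^*$. $SG_r=\{\tau^ig^{pj}: 1\le i\le p^{r-1}(p-1),\ 1\le j\le p^{r-1}\}\cong\mathbb{Z}_{p^{r-1}}\rtimes\mathbb{Z}_{p^r}^*$, a subgroup of $G_r$. **Hooks and blocks.** $\lambda(k,i)$ denotes the hook partition $[k-i,1^i]$ with $k$ boxes. Adding the block $B_{m,n}$ to a hook means adding $m$ nodes at the end of the first row and $n$ nodes at the end of the first column. **Index sets.** For $r\ge 1$: $V^r_0=W^r_0=\{\lambda(p^{r-1}(p-1),i): 0\le i<p^{r-1}(p-1)\}$. For $1\le s\le r$: $V^r_s=\{\lambda(p^{r-s}[2sp-(2s+1)],i): p^{r-s}[sp-(s+1)]\le i<sp^{r-s}(p-1)\}$. For $1\le s\le r-1$: $W^r_s=\{\lambda(p^{r-s-1}[(2s+1)p-2(s+1)],i): p^{r-s-1}[sp-(s+1)]\le i<(s+1)p^{r-s-1}(p-1)\}$. **Standard $\boldsymbol{p}$-Young tableaux.** A shape in $V^r_0=W^r_0$ has exactly one standard $\boldsymbol{p}$-Young tableau (a single block, all nodes filled with $1$). For $\lambda\in V^r_s$, $1\le s\le r$, put $q=p^{r-s}$. A standard $\boldsymbol{p}$-Young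 tableau of shape $\lambda$ is a chain of hooks $\lambda^{(1)},\dots,\lambda^{(2s)}=\lambda$ with $\lambda^{(2m-1)}\in W^{r-s+m}_{m-1}$ and $\lambda^{(2m)}\in V^{r-s+m}_m$ for $1\le m\le s$, where $\lambda^{(2)}$ is obtained from $\lambda^{(1)}$ by adding a block $B_{q(p-2-t'),\,qt'}$ with $0\le t'\le p-2$, and for $n\ge 3$, $\lambda^{(n)}$ is obtained from $\lambda^{(n-1)}$ by adding a block $B_{q(p-1-t'),\,qt'}$ with $0\le t'\le p-1$. For $\lambda\in W^r_s$, $1\le s\le r-1$, put $q=p^{r-s-1}$. A standard $\boldsymbol{p}$-Young tableau of shape $\lambda$ is a chain $\lambda^{(1)},\dots,\lambda^{(2s)},\lambda^{(2s+1)}=\lambda$ such that $(\lambda^{(1)},\dots,\lambda^{(2s)})$ is a standard $\boldsymbol{p}$-Young tableau of a shape in $V^{r-1}_s$ and $\lambda$ is obtained from $\lambda^{(2s)}$ by adding a block $B_{q(p-1-t'),\,qt'}$, $0\le t'\le p-1$. (The nodes of the $n$-th block are filled with $n$; the first block is $\lambda^{(1)}$.) $\mathrm{SYT}_p(\lambda)$ is the set of standard $\boldsymbol{p}$-Young tableaux of shape $\lambda$. **Numbers of block types.** For $q$ a power of $p$, the block type $B_{q(p-1)/2+qm,\;q(p-1)/2-qm}$ has number $2m+1$ ($0\le m\le\frac{p-1}{2}$), and $B_{q(p-1)/2-qm,\;q(p-1)/2+qm}$ has number $2m$ ($1\le m\le \frac{p-1}{2}$). **Integer number of a tableau.** Let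 $(\lambda^{(1)},\dots,\lambda^{(2s)})$ be a standard $\boldsymbol{p}$-Young tableau of shape in $V^r_s$, $1\le s\le r$. For $1\le n\le s-1$ let $i_n\in\{1,\dots,p\}$ be the number of the type of the block added in passing from $\lambda^{(2(s-n+1)-1)}$ to $\lambda^{(2(s-n+1))}$ (so $i_1$ comes from the last block). - If $s=r$: write $\lambda^{(1)}=\lambda(p-1,u)$, $0\le u\le p-2$. Let $i_r=2u+1$ if $u<\frac{p-1}{2}$, and $i_r=2(t_1+1)$ if $u=p-2-t_1$ with $0\le t_1<\frac{p-1}{2}$. The number of the tableau is $i_1+p(i_2-1)+\dots+p^{r-2}(i_{r-1}-1)+p^{r-1}(i_r-1)$ (for $r=1$ it is $i_1$). - If $1\le s\le r-1$: write $\lambda^{(1)}=\lambda(p^{r-s}(p-1),u)$ and let $j'$ be the integer with $j'p^{r-s}\le u<(j'+1)p^{r-s}$. The number is $1+j'+p^{s-2}(p-1)(i_1-1)+\sum_{n=1}^{s-2}p^{n-1}(p-1)(i_{n+1}-1)$ if $s>1$, and $1+j'$ if $s=1$. The number of a standard $\boldsymbol{p}$-Young tableau of shape in $W^r_s$, $1\le s\le r-1$, is the number of the tableau of shape in $V^{r-1}_s$ obtained by removing its last block. $P_j$ denotes the tableau of the given shape with number $j$. **The integer $l(\lambda)$.** For $\lambda=\lambda(k,k')\in W^r_s$, $1\le s\le r-1$, $k=p^{r-s-1}[(2s+1)p-2(s+1)]$, write $k'=\frac{k-1}{2}+\sum_{i=1}^{r-s}\varepsilon_i p^{r-s-i}j_i$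 with $\varepsilon_i\in\{1,-1\}$, $0\le j_i\le\frac{p-1}{2}$. Then $l(\lambda)=(p-1)\sum_{i=1}^{r-s}p^{r-s-i}\nu(j_i)$, where $\nu(j_i)=0$ if $j_i=0$, and otherwise $\nu(j_i)=2j_i$ if $\varepsilon_i=-1$ and $\nu(j_i)=2j_i-1$ if $\varepsilon_i=1$. Only $l$ modulo $p^{r-s}$ matters. **One-dimensional shapes.** $k'\mapsto j(k')$ is a fixed bijection from $\{0,\dots,p^{r-1}(p-1)-1\}$ to itself (matching $\lambda(p^{r-1}(p-1),k')$ with the one-dimensional representation it indexes). *)

theory Defs
  imports "HOL-Number_Theory.Number_Theory" "HOL-Algebra.Multiplicative_Group"
begin

section \<open>The groups\<close>

text \<open>\<open>G\<close> is presented by \<open>g\<close> and \<open>\<tau>\<close> as the semidirect product of \<open>\<int>/p^r\<close> by its unit group.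
  Since \<open>t\<close> is a primitive root modulo \<open>p^r\<close>, a power of \<open>\<tau>\<close> commutes with \<open>g\<close> only if it is
  trivial, so the cyclic subgroups generated by \<open>g\<close> and \<open>\<tau>\<close> meet trivially and the listed
  elements of \<open>G\<close> are automatically distinct.\<close>

definition is_G :: "nat \<Rightarrow> nat \<Rightarrow> nat \<Rightarrow> ('a, 'b) monoid_scheme \<Rightarrow> 'a \<Rightarrow> 'a \<Rightarrow> bool" where
  "is_G p r t G g \<tau> \<longleftrightarrow>
     group G \<and> g \<in> carrier G \<and> \<tau> \<in> carrier G \<and>
     group.ord G g = p ^ r \<and> group.ord G \<tau> = p ^ (r - 1) * (p - 1) \<and>
     residue_primroot (p ^ r) t \<and>
     inv\<^bsub>G\<^esub> \<tau> \<otimes>\<^bsub>G\<^esub> g \<otimes>\<^bsub>G\<^esub> \<tau> = g [^]\<^bsub>G\<^esub> t \<and>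
     carrier G = {\<tau> [^]\<^bsub>G\<^esub> i \<otimes>\<^bsub>G\<^esub> g [^]\<^bsub>G\<^esub> j | i j :: nat.
       1 \<le> i \<and> i \<le> p ^ (r - 1) * (p - 1) \<and> 1 \<le> j \<and> j \<le> p ^ r}"

definition SG :: "nat \<Rightarrow> nat \<Rightarrow> ('a, 'b) monoid_scheme \<Rightarrow> 'a \<Rightarrow> 'a \<Rightarrow> 'a set" where
  "SG p r G g \<tau> = {\<tau> [^]\<^bsub>G\<^esub> i \<otimes>\<^bsub>G\<^esub> g [^]\<^bsub>G\<^esub> (p * j) | i j :: nat.
     1 \<le> i \<and> i \<le> p ^ (r - 1) * (p - 1) \<and> 1 \<le> j \<and> j \<le> p ^ (r - 1)}"


section \<open>Hooks and blocks\<close>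

text \<open>Partitions are lists of row lengths; \<open>hook k i\<close> is \<open>[k - i, 1^i]\<close>, meaningful for \<open>i < k\<close>.\<close>

definition hook :: "nat \<Rightarrow> nat \<Rightarrow> nat list" where
  "hook k i = (k - i) # replicate i 1"

definition leg :: "nat list \<Rightarrow> nat" where
  "leg h = length h - 1"

lemma leg_hook [simp]: "leg (hook k i) = i"
  by (simp add: leg_def hook_def)

lemma sum_list_hook: "i \<le> k \<Longrightarrow> sum_list (hook k i) = k"
  by (simp add: hook_def sum_list_replicate)

definition add_block :: "nat \<Rightarrow> nat \<Rightarrow> nat list \<Rightarrow> nat list" where
  "add_block m n h = (hd h + m) # tl h @ replicate n 1"

lemma add_block_hook: "i \<le> k \<Longrightarrow> add_block m n (hook k i) = hook (k + m + n) (i + n)"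
  by (simp add: add_block_def hook_def replicate_add)

text \<open>The index sets for \<open>0 \<le> s \<le> r\<close> (for \<open>V\<close>) and \<open>0 \<le> s \<le> r - 1\<close> (for \<open>W\<close>).
  For \<open>p \<ge> 3\<close> none of the subtractions is truncated on these ranges.\<close>

definition V_shapes :: "nat \<Rightarrow> nat \<Rightarrow> nat \<Rightarrow> nat list set" where
  "V_shapes p r s =
     (if s = 0 then {hook (p ^ (r - 1) * (p - 1)) i | i. i < p ^ (r - 1) * (p - 1)}
      else {hook (p ^ (r - s) * (2 * s * p - (2 * s + 1))) i | i.
              p ^ (r - s) * (s * p - (s + 1)) \<le> i \<and> i < s * p ^ (r - s) * (p - 1)})"

definition W_shapes :: "nat \<Rightarrow> nat \<Rightarrow> nat \<Rightarrow> nat list set" where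
  "W_shapes p r s =
     (if s = 0 then {hook (p ^ (r - 1) * (p - 1)) i | i. i < p ^ (r - 1) * (p - 1)}
      else {hook (p ^ (r - s - 1) * ((2 * s + 1) * p - 2 * (s + 1))) i | i.
              p ^ (r - s - 1) * (s * p - (s + 1)) \<le> i \<and> i < (s + 1) * p ^ (r - s - 1) * (p - 1)})"


section \<open>Standard tableaux\<close>

text \<open>A tableau is the list \<open>[\<lambda>\<^sup>(\<^sup>1\<^sup>), \<lambda>\<^sup>(\<^sup>2\<^sup>), \<dots>]\<close> of its chain of hooks, whose last
  entry is its shape; \<open>chain_nth T n\<close> is the hook with the one-based index \<open>n\<close>.\<close>

abbreviation chain_nth :: "nat list list \<Rightarrow> nat \<Rightarrow> nat list" where
  "chain_nth T n \<equiv> T ! (n - 1)"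

definition SYT_V :: "nat \<Rightarrow> nat \<Rightarrow> nat \<Rightarrow> nat list \<Rightarrow> nat list list set" where
  "SYT_V p r s h =
     (if s = 0 then {[h]}
      else {T. length T = 2 * s \<and> chain_nth T (2 * s) = h \<and>
        (\<forall>m\<in>{1..s}. chain_nth T (2 * m - 1) \<in> W_shapes p (r - s + m) (m - 1) \<and>
                     chain_nth T (2 * m) \<in> V_shapes p (r - s + m) m) \<and>
        (\<exists>t'\<in>{0..p - 2}. chain_nth T 2 =
           add_block (p ^ (r - s) * (p - 2 - t')) (p ^ (r - s) * t') (chain_nth T 1)) \<and>
        (\<forall>n\<in>{3..2 * s}. \<exists>t'\<in>{0..p - 1}. chain_nth T n =
           add_block (p ^ (r - s) * (p - 1 - t')) (p ^ (r - s) * t') (chain_nth T (n - 1)))})"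

definition SYT_W :: "nat \<Rightarrow> nat \<Rightarrow> nat \<Rightarrow> nat list \<Rightarrow> nat list list set" where
  "SYT_W p r s h =
     (if s = 0 then {[h]}
      else {T @ [h] | T. \<exists>h'\<in>V_shapes p (r - 1) s. T \<in> SYT_V p (r - 1) s h' \<and>
        (\<exists>t'\<in>{0..p - 1}.
           h = add_block (p ^ (r - s - 1) * (p - 1 - t')) (p ^ (r - s - 1) * t') h')})"

definition tableau_pairs :: "nat \<Rightarrow> nat \<Rightarrow> (nat list list \<times> nat list list) set" where
  "tableau_pairs p r = (\<Union>s\<in>{0..r - 1}. \<Union>h\<in>W_shapes p r s. SYT_W p r s h \<times> SYT_W p r s h)"


section \<open>The integer number of a tableau\<close>

definition block_type_has_number :: "nat \<Rightarrow> nat \<Rightarrow> nat \<Rightarrow> nat \<Rightarrow> bool" where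
  "block_type_has_number p a b c \<longleftrightarrow>
     (\<exists>e m q. q = p ^ e \<and> m \<le> (p - 1) div 2 \<and>
        (a = q * (p - 1) div 2 + q * m \<and> b = q * (p - 1) div 2 - q * m \<and> c = 2 * m + 1 \<or>
         1 \<le> m \<and> a = q * (p - 1) div 2 - q * m \<and> b = q * (p - 1) div 2 + q * m \<and> c = 2 * m))"

definition step_number :: "nat \<Rightarrow> nat list \<Rightarrow> nat list \<Rightarrow> nat" where
  "step_number p h h' = (THE c. \<exists>a b. h' = add_block a b h \<and> block_type_has_number p a b c)"

text \<open>The number \<open>i\<^sub>n\<close>, for \<open>1 \<le> n \<le> s - 1\<close>, of a tableau of shape in \<open>V_shapes p r s\<close>.\<close>

definition block_idx :: "nat \<Rightarrow> nat \<Rightarrow> nat list list \<Rightarrow> nat \<Rightarrow> nat" where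
  "block_idx p s T n =
     step_number p (chain_nth T (2 * (s - n + 1) - 1)) (chain_nth T (2 * (s - n + 1)))"

text \<open>The number \<open>i\<^sub>r\<close> read off from \<open>\<lambda>\<^sup>(\<^sup>1\<^sup>) = \<lambda>(p - 1, u)\<close>; in the second case
  \<open>t\<^sub>1 = p - 2 - u\<close>.\<close>

definition first_idx :: "nat \<Rightarrow> nat \<Rightarrow> nat" where
  "first_idx p u = (if u < (p - 1) div 2 then 2 * u + 1 else 2 * ((p - 2 - u) + 1))"

definition number_V :: "nat \<Rightarrow> nat \<Rightarrow> nat \<Rightarrow> nat list list \<Rightarrow> nat" where
  "number_V p r s T =
     (let u = leg (chain_nth T 1) in
      if s = r then
        (let i = (\<lambda>n. if n = r then first_idx p u else block_idx p s T n)
         in i 1 + (\<Sum>n = 2..r. p ^ (n - 1) * (i n - 1)))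
      else
        (let i = block_idx p s T; j' = u div p ^ (r - s)
         in if s > 1
            then 1 + j' + p ^ (s - 2) * (p - 1) * (i 1 - 1)
                 + (\<Sum>n = 1..s - 2. p ^ (n - 1) * (p - 1) * (i (n + 1) - 1))
            else 1 + j'))"

definition number_W :: "nat \<Rightarrow> nat \<Rightarrow> nat \<Rightarrow> nat list list \<Rightarrow> nat" where
  "number_W p r s T = number_V p (r - 1) s (butlast T)"


section \<open>The integer \<open>l(\<lambda>)\<close>\<close>

definition nu :: "int \<Rightarrow> nat \<Rightarrow> nat" where
  "nu \<epsilon> j = (if j = 0 then 0 else if \<epsilon> = -1 then 2 * j else 2 * j - 1)"

text \<open>The sign of a zero digit is not determined by \<open>k'\<close>, but \<open>nu\<close> ignores it, so \<open>l\<close> is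
  well-defined. The argument \<open>h\<close> is the shape \<open>\<lambda>(k, k')\<close> in \<open>W_shapes p r s\<close>.\<close>

definition l_of :: "nat \<Rightarrow> nat \<Rightarrow> nat \<Rightarrow> nat list \<Rightarrow> nat" where
  "l_of p r s h =
     (let k = p ^ (r - s - 1) * ((2 * s + 1) * p - 2 * (s + 1)); k' = leg h in
      THE l. \<exists>(\<epsilon> :: nat \<Rightarrow> int) (j :: nat \<Rightarrow> nat).
        (\<forall>i\<in>{1..r - s}. \<epsilon> i \<in> {1, -1} \<and> j i \<le> (p - 1) div 2) \<and>
        int k' = int ((k - 1) div 2) + (\<Sum>i = 1..r - s. \<epsilon> i * int (p ^ (r - s - i)) * int (j i)) \<and>
        l = (p - 1) * (\<Sum>i = 1..r - s. p ^ (r - s - i) * nu (\<epsilon> i) (j i)))"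


section \<open>The map \<open>h'\<close>\<close>

text \<open>The chain of a tableau of shape in \<open>W_shapes p r s\<close> has \<open>2 * s + 1\<close> entries, from which
  \<open>s\<close> is recovered.\<close>

lemma length_SYT_W: "T \<in> SYT_W p r s h \<Longrightarrow> length T = 2 * s + 1 \<and> last T = h"
  by (auto simp: SYT_W_def SYT_V_def split: if_splits)

definition h_map ::
  "nat \<Rightarrow> nat \<Rightarrow> ('a, 'b) monoid_scheme \<Rightarrow> 'a \<Rightarrow> 'a \<Rightarrow> (nat \<Rightarrow> nat) \<Rightarrow>
   nat list list \<times> nat list list \<Rightarrow> 'a" where
  "h_map p r G g \<tau> jmap = (\<lambda>(P, Q).
     let s = (length P - 1) div 2; h = last P in
     if s = 0 then \<tau> [^]\<^bsub>G\<^esub> jmap (leg h)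
     else
       (let i = number_W p r s P; j = number_W p r s Q; l = l_of p r s h;
            \<tau>star = \<tau> [^]\<^bsub>G\<^esub> (p ^ (r - 1) * (p - 1) div 2)
        in \<tau> [^]\<^bsub>G\<^esub> (- (int i - 1)) \<otimes>\<^bsub>G\<^esub> (g [^]\<^bsub>G\<^esub> p) [^]\<^bsub>G\<^esub> (p ^ (r - s - 1)) \<otimes>\<^bsub>G\<^esub> \<tau>star
           \<otimes>\<^bsub>G\<^esub> \<tau> [^]\<^bsub>G\<^esub> (j - 1) \<otimes>\<^bsub>G\<^esub> \<tau> [^]\<^bsub>G\<^esub> (l * p ^ (s - 1) * (p - 1))))"

end

theory Submission
  imports Defs
begin

text \<open>The legs of the hooks in a chain all agree modulo \<open>q = p ^ (r - s - 1)\<close>, and the quotient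
  by \<open>q\<close> is forced at every \<open>V\<close>-shape, whereas at a \<open>W\<close>-shape it is one of \<open>p - 1\<close> values (first
  hook) or \<open>p\<close> values (later hooks). So a tableau of given shape is a list of \<open>s\<close> free digits, of which
  its number is a mixed-radix expansion; hence the numbering is injective and each shape has
  \<open>p ^ (s - 1) * (p - 1)\<close> tableaux. Likewise \<open>l\<close> applies a permutation to the base-\<open>p\<close> digits of the
  leg, so it is injective on \<open>W_shapes p r s\<close>.

  On the group side, the value of \<open>h_map\<close> at level \<open>s\<close> is \<open>\<tau> ^ (z + e) g ^ (p ^ (r - s) t ^ e)\<close>. Its
  exponents determine \<open>s\<close>, then \<open>t ^ e\<close> modulo \<open>p ^ s\<close>, and from these \<open>i\<close>, \<open>j\<close> and \<open>l\<close>. Thus \<open>h_map\<close>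
  is injective, and it is onto because the pairs of tableaux number
  \<open>p ^ (r - 1) * (p - 1) * p ^ (r - 1)\<close>, at least the cardinality of \<open>SG\<close>.\<close>

section \<open>Digit sums and primitive roots\<close>

lemma digit_sum_less:
  fixes p :: nat
  assumes "\<And>i. i < n \<Longrightarrow> e i < p"
  shows "(\<Sum>i<n. p ^ i * e i) < p ^ n"
  using assms
proof (induction n)
  case (Suc n)
  have "(\<Sum>i<Suc n. p ^ i * e i) < p ^ n + p ^ n * e n"
    using Suc by simp
  also have "\<dots> = p ^ n * Suc (e n)" by simp
  also have "\<dots> \<le> p ^ n * p" using Suc.prems[of n] by (intro mult_le_mono2) simp
  finally show ?case by (simp add: mult.commute)
qed simp

text \<open>One step of reading off a mixed-radix expansion: reduction modulo \<open>m\<close>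
  isolates the low part. Keeping \<open>m\<close> arbitrary lets it serve powers of \<open>p\<close>
  as well as the radix \<open>p - 1\<close>.\<close>

lemma add_mult_inj:
  fixes m :: nat
  assumes "a + m * b = a' + m * b'" "a < m" "a' < m"
  shows "a = a' \<and> b = b'"
proof -
  have "a = (a + m * b) mod m" using assms(2) by simp
  also have "\<dots> = a'" using assms(1,3) by simp
  finally have "a = a'" .
  with assms show ?thesis by simp
qed

lemma add_mult_less:
  fixes m :: nat
  assumes "a < m" "b < k"
  shows "a + m * b < m * k"
proof -
  have "a + m * b < m * Suc b" using assms by simp
  also have "\<dots> \<le> m * k" using assms by (intro mult_le_mono2) simp
  finally show ?thesis .
qed

lemma digit_sum_inj:
  fixes p :: nat
  assumes "\<And>i. i < n \<Longrightarrow> e i < p" "\<And>i. i < n \<Longrightarrow> e' i < p"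
    and "(\<Sum>i<n. p ^ i * e i) = (\<Sum>i<n. p ^ i * e' i)" and "i < n"
  shows "e i = e' i"
  using assms
proof (induction n)
  case (Suc n)
  have "(\<Sum>i<n. p ^ i * e i) = (\<Sum>i<n. p ^ i * e' i) \<and> e n = e' n"
    by (rule add_mult_inj[where m = "p ^ n"]) (use Suc.prems in \<open>auto intro!: digit_sum_less\<close>)
  with Suc show ?case by (cases "i = n") auto
qed simp

lemma digit_sum_surj:
  fixes p :: nat
  assumes "N < p ^ n"
  shows "\<exists>e. (\<forall>i<n. e i < p) \<and> N = (\<Sum>i<n. p ^ i * e i)"
  using assms
proof (induction n arbitrary: N)
  case (Suc n)
  then have "p > 0" by (cases "p = 0") auto
  then have "N mod p ^ n < p ^ n" by simp
  from Suc.IH[OF this] obtain e where e: "\<forall>i<n. e i < p" "N mod p ^ n = (\<Sum>i<n. p ^ i * e i)"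
    by blast
  have "N div p ^ n < p"
    using Suc.prems by (simp add: less_mult_imp_div_less)
  with e show ?case
    by (intro exI[of _ "e(n := N div p ^ n)"]) (auto simp: less_Suc_eq simp flip: e(2))
qed simp

text \<open>\<open>zigzag p t + 1\<close> is the number of the block type \<open>B\<close> with arm \<open>q * (p - 1 - t)\<close> and leg \<open>q * t\<close>, and
  \<open>zigzag p t\<close> is also \<open>nu\<close> of the balanced digit \<open>t - (p - 1) div 2\<close>.\<close>

definition zigzag :: "nat \<Rightarrow> nat \<Rightarrow> nat" where
  "zigzag p t = (let h = (p - 1) div 2 in if t \<le> h then 2 * (h - t) else 2 * (t - h) - 1)"

lemma zigzag_less: "odd p \<Longrightarrow> t < p \<Longrightarrow> zigzag p t < p"
  by (auto simp: zigzag_def Let_def elim!: oddE)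

text \<open>The two branches of \<open>zigzag\<close>, and likewise those of
  \<open>first_idx\<close>, take values of opposite parity, so a value reveals the branch it came
  from.\<close>

lemma odd_neq_even: "0 < a \<Longrightarrow> 2 * a - 1 \<noteq> 2 * (b :: nat)"
  by presburger

lemma zigzag_inj:
  assumes "zigzag p t = zigzag p t'"
  shows "t = t'"
proof -
  define h where "h = (p - 1) div 2"
  have "(if t \<le> h then 2 * (h - t) else 2 * (t - h) - 1) =
    (if t' \<le> h then 2 * (h - t') else 2 * (t' - h) - 1)"
    using assms by (simp only: zigzag_def Let_def h_def)
  with odd_neq_even[of "t - h" "h - t'"] odd_neq_even[of "t' - h" "h - t"] show ?thesis
    by (cases "t \<le> h"; cases "t' \<le> h") simp_all
qed

lemma first_idx_pos: "u < p - 1 \<Longrightarrow> first_idx p u \<ge> 1"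
  by (auto simp: first_idx_def)

lemma first_idx_le: "odd p \<Longrightarrow> u < p - 1 \<Longrightarrow> first_idx p u \<le> p - 1"
  by (auto simp: first_idx_def elim!: oddE)

lemma first_idx_inj:
  assumes "first_idx p u = first_idx p u'" "u < p - 1" "u' < p - 1"
  shows "u = u'"
  using assms odd_neq_even[of "Suc u" "p - 1 - u'"] odd_neq_even[of "Suc u'" "p - 1 - u"]
  unfolding first_idx_def by (simp split: if_splits) linarith

text \<open>Each \<open>p\<close>-th power gains a factor \<open>p\<close>: in b^p - 1 = (b - 1)(1 +
  b + ... + b^(p-1)) the second factor is congruent to a sum of \<open>p\<close> ones, hence to 0,
  modulo \<open>p\<close>.\<close>

lemma power_prime_cong_1:
  fixes a :: int
  assumes "[a = 1] (mod int p ^ s)" "s > 0"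
  shows "[a ^ p ^ k = 1] (mod int p ^ (s + k))"
proof (induction k)
  case (Suc k)
  define b where "b = a ^ p ^ k"
  have "[b = 1] (mod int p)"
    using cong_modulus_mult[of b 1 "int p"] Suc \<open>s > 0\<close> cong_dvd_modulus[OF Suc, of "int p"]
    by (simp add: b_def)
  then have "[(\<Sum>i<p. b ^ i) = (\<Sum>i<p. 1 ^ i)] (mod int p)"
    by (intro cong_sum cong_pow)
  then have "int p dvd (\<Sum>i<p. b ^ i)"
    by (simp add: cong_def mod_0_imp_dvd)
  moreover have "int p ^ (s + k) dvd b - 1"
    using Suc by (simp add: cong_iff_dvd_diff b_def)
  ultimately have "int p ^ (s + k) * int p dvd (b - 1) * (\<Sum>i<p. b ^ i)"
    by (intro mult_dvd_mono)
  also have "(b - 1) * (\<Sum>i<p. b ^ i) = b ^ p - 1"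
    by (rule power_diff_1_eq[symmetric])
  also have "b ^ p = a ^ p ^ Suc k"
    by (simp add: b_def power_mult[symmetric] mult.commute)
  finally show ?case by (simp add: cong_iff_dvd_diff mult.commute)
qed (use assms in auto)

text \<open>If \<open>t\<close> has order e modulo \<open>p ^ s\<close>, then t^(e p^(r-s)) is 1
  modulo \<open>p ^ r\<close>. Hence the totient of \<open>p ^ r\<close>, which is that of
  \<open>p ^ s\<close> times p^(r-s), divides e p^(r-s), and cancelling shows that e is as large as
  possible.\<close>

lemma residue_primroot_prime_power_le:
  assumes "prime p" "residue_primroot (p ^ r) t" "0 < s" "s \<le> r"
  shows "residue_primroot (p ^ s) t"
proof -
  have p: "p > 0" using assms by (simp add: prime_gt_0_nat)
  have cop: "coprime (p ^ s) t" "coprime (p ^ r) t"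
    using assms by (auto simp: residue_primroot_def)
  let ?e = "ord (p ^ s) t"
  have "[t ^ ?e = 1] (mod p ^ s)" by (rule ord)
  then have "[int t ^ ?e = 1] (mod int p ^ s)"
    using cong_int_iff[of "t ^ ?e" 1 "p ^ s"] by simp
  from power_prime_cong_1[OF this \<open>0 < s\<close>, of "r - s"]
  have "[int t ^ (?e * p ^ (r - s)) = 1] (mod int p ^ r)"
    using assms by (simp add: power_mult)
  then have "[t ^ (?e * p ^ (r - s)) = 1] (mod p ^ r)"
    using cong_int_iff[of "t ^ (?e * p ^ (r - s))" 1 "p ^ r"] by simp
  then have "totient (p ^ r) dvd ?e * p ^ (r - s)"
    using assms(2) ord_divides[of t "?e * p ^ (r - s)" "p ^ r"] unfolding residue_primroot_def by metis
  moreover have "totient (p ^ r) = totient (p ^ s) * p ^ (r - s)"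
  proof -
    have "r - 1 = (s - 1) + (r - s)" using assms by simp
    then have "p ^ (r - 1) = p ^ (s - 1) * p ^ (r - s)" by (simp only: power_add)
    then show ?thesis using assms by (simp add: totient_prime_power)
  qed
  ultimately have "totient (p ^ s) dvd ?e" using p by simp
  moreover have "?e dvd totient (p ^ s)"
    using euler_theorem[of t "p ^ s"] cop ord_divides[of t "totient (p ^ s)" "p ^ s"]
    by (metis coprime_commute)
  ultimately show ?thesis using cop p by (simp add: residue_primroot_def dvd_antisym)
qed

section \<open>Standard tableaux as digit sequences\<close>

text \<open>The least quotient of a leg by \<open>q\<close>. At \<open>V\<close>-shapes of index
  \<open>m > 0\<close> the quotient is exactly this; at \<open>W\<close>-shapes of index
  \<open>m\<close> it exceeds it by a digit below \<open>leg_width p m\<close>.\<close>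

definition leg_base :: "nat \<Rightarrow> nat \<Rightarrow> nat" where
  "leg_base p m = (if m = 0 then 0 else m * (p - 1) - 1)"

definition leg_width :: "nat \<Rightarrow> nat \<Rightarrow> nat" where
  "leg_width p m = (if m = 0 then p - 1 else p)"

text \<open>In units of \<open>q\<close>, the size of the block added to entry \<open>i\<close> of a
  chain, entries being counted from zero.\<close>

definition block_size :: "nat \<Rightarrow> nat \<Rightarrow> nat" where
  "block_size p i = (if i = 0 then p - 2 else p - 1)"

text \<open>One formula for both families: with entries counted from zero, index
  \<open>2 * s\<close> gives the size of the hooks in \<open>W\<close> of index \<open>s\<close>,
  and \<open>2 * s - 1\<close> that of the hooks in \<open>V\<close> of index
  \<open>s > 0\<close>.\<close>

definition hook_size :: "nat \<Rightarrow> nat \<Rightarrow> nat \<Rightarrow> nat" where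
  "hook_size p q i = q * (if i = 0 then p - 1 else (i + 1) * (p - 1) - 1)"

definition tableau_leg :: "nat \<Rightarrow> nat \<Rightarrow> nat \<Rightarrow> (nat \<Rightarrow> nat) \<Rightarrow> nat \<Rightarrow> nat" where
  "tableau_leg p q c d i = q * (leg_base p (Suc i div 2) + (if even i then d (i div 2) else 0)) + c"

text \<open>Entry \<open>2 * m\<close> is the \<open>W\<close>-shape of index \<open>m\<close>,
  entry \<open>2 * m - 1\<close> the \<open>V\<close>-shape of index \<open>m\<close>. The final
  shape determines \<open>c\<close> and \<open>d s\<close>, which leaves \<open>d 0\<close> up to
  \<open>d (s - 1)\<close> free.\<close>

definition tableau :: "nat \<Rightarrow> nat \<Rightarrow> nat \<Rightarrow> nat \<Rightarrow> (nat \<Rightarrow> nat) \<Rightarrow> nat list list" where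
  "tableau p q s c d = map (\<lambda>i. hook (hook_size p q i) (tableau_leg p q c d i)) [0..<Suc (2 * s)]"

section \<open>Sizes and legs along a chain\<close>

lemma leg_add_block_hook: "leg (add_block a b (hook k i)) = i + b"
  by (simp add: leg_def add_block_def hook_def)

lemma hook_inject: "hook k i = hook k' i' \<Longrightarrow> i = i'"
  by (metis leg_hook)

lemma add_block_inject: "add_block a b h = add_block a' b' h \<longleftrightarrow> a = a' \<and> b = b'"
  by (auto simp: add_block_def)

lemma hook_size_Suc:
  assumes "p \<ge> 3"
  shows "hook_size p q (Suc i) = hook_size p q i + q * block_size p i"
proof -
  obtain k where "p = k + 3" using assms by (metis add.commute le_Suc_ex)
  then show ?thesis by (simp add: hook_size_def block_size_def algebra_simps)
qed

text \<open>A step out of a \<open>W\<close>-shape must reach the forced quotient of the next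
  \<open>V\<close>-shape, so the leg of its block is complementary to the current digit. A step out
  of a \<open>V\<close>-shape introduces the next digit as the leg of its block.\<close>

lemma tableau_leg_Suc:
  assumes "p \<ge> 3" "d 0 < p - 1" "\<And>m. 0 < m \<Longrightarrow> m \<le> i div 2 \<Longrightarrow> d m < p"
  shows "tableau_leg p q c d (Suc i) = tableau_leg p q c d i +
    q * (if even i then block_size p i - d (i div 2) else d (Suc i div 2))"
proof (cases "even i")
  case True
  then obtain m where i: "i = 2 * m" by blast
  obtain k where p: "p = k + 3" using assms by (metis add.commute le_Suc_ex)
  show ?thesis
  proof (cases "m = 0")
    case True
    then show ?thesis using assms(2) p i
      by (simp add: tableau_leg_def leg_base_def block_size_def flip: add_mult_distrib2)
  next
    case False
    then have "d m \<le> p - 1" using assms(3)[of m] i by simp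
    then have "leg_base p (Suc m) = leg_base p m + d m + (p - 1 - d m)"
      using False p by (cases m) (simp_all add: leg_base_def)
    then show ?thesis using i False
      by (simp add: tableau_leg_def block_size_def algebra_simps)
  qed
next
  case False
  then obtain m where "i = 2 * m + 1" using oddE by blast
  then show ?thesis
    by (simp add: tableau_leg_def algebra_simps)
qed

section \<open>Shapes as intervals of legs, and tableaux as chains counted from zero\<close>

lemma W_shapes_eq:
  assumes "p \<ge> 3" "s \<le> r - 1" "q = p ^ (r - s - 1)"
  shows "W_shapes p r s = {hook (hook_size p q (2 * s)) i | i.
    q * leg_base p s \<le> i \<and> i < q * (leg_base p s + leg_width p s)}"
proof (cases "s = 0")
  case False
  obtain k where p: "p = k + 3" using assms by (metis add.commute le_Suc_ex)
  have "q * ((2 * s + 1) * p - 2 * (s + 1)) = hook_size p q (2 * s)"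
    using False p by (simp add: hook_size_def algebra_simps)
  moreover have "s * p - (s + 1) = leg_base p s"
    using False p by (simp add: leg_base_def algebra_simps)
  moreover have "(s + 1) * q * (p - 1) = q * (leg_base p s + leg_width p s)"
  proof -
    have "s * (p - 1) \<ge> 1" using False p by simp
    then have "(s + 1) * (p - 1) = leg_base p s + leg_width p s"
      using False p by (simp add: leg_base_def leg_width_def)
    then show ?thesis by (metis mult.assoc mult.commute)
  qed
  ultimately show ?thesis
    using False by (simp only: W_shapes_def assms(3)[symmetric] if_False)
qed (simp add: W_shapes_def hook_size_def leg_base_def leg_width_def assms)

lemma V_shapes_eq:
  assumes "p \<ge> 3" "0 < s" "q = p ^ (r - s)"
  shows "V_shapes p r s = {hook (hook_size p q (2 * s - 1)) i | i.
    q * leg_base p s \<le> i \<and> i < q * (leg_base p s + 1)}"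
proof -
  obtain k where p: "p = k + 3" using assms by (metis add.commute le_Suc_ex)
  obtain s' where s: "s = Suc s'" using assms gr0_implies_Suc by blast
  have "q * (2 * s * p - (2 * s + 1)) = hook_size p q (2 * s - 1)"
    using p s by (simp add: hook_size_def algebra_simps)
  moreover have "s * p - (s + 1) = leg_base p s"
    using p s by (simp add: leg_base_def algebra_simps)
  moreover have "s * q * (p - 1) = q * (leg_base p s + 1)"
    using p s by (simp add: leg_base_def algebra_simps)
  ultimately show ?thesis
    using assms(2) by (simp only: V_shapes_def assms(3)[symmetric] if_not_P[OF gr_implies_not0[OF assms(2)]])
qed

text \<open>The part of the chain without its last hook has rank \<open>r - 1\<close>, so its scale
  \<open>p ^ (r - 1 - s)\<close> is that of the last block. All block conditions therefore merge
  into one, with the exceptional first block absorbed by \<open>block_size\<close>.\<close>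

lemma SYT_W_iff:
  assumes "p \<ge> 3" "0 < s" "s \<le> r - 1" "q = p ^ (r - s - 1)"
  shows "T \<in> SYT_W p r s h \<longleftrightarrow> length T = Suc (2 * s) \<and> T ! (2 * s) = h \<and>
    (\<forall>m\<in>{1..s}. T ! (2 * m - 2) \<in> W_shapes p (r - 1 - s + m) (m - 1) \<and>
                 T ! (2 * m - 1) \<in> V_shapes p (r - 1 - s + m) m) \<and>
    (\<forall>i<2 * s. \<exists>t\<le>block_size p i.
       T ! Suc i = add_block (q * (block_size p i - t)) (q * t) (T ! i))" (is "_ \<longleftrightarrow> ?R")
proof -
  have s0: "s \<noteq> 0" and q: "p ^ (r - 1 - s) = q" using assms by simp_all
  show ?thesis
  proof
    assume "T \<in> SYT_W p r s h"
    then obtain T' h' where T: "T = T' @ [h]" and h': "h' \<in> V_shapes p (r - 1) s"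
      and T': "T' \<in> SYT_V p (r - 1) s h'"
      and last: "\<exists>t\<in>{0..p - 1}. h = add_block (q * (p - 1 - t)) (q * t) h'"
      using assms by (auto simp: SYT_W_def)
    have len: "length T' = 2 * s" and lst: "T' ! (2 * s - 1) = h'"
      and shapes: "\<forall>m\<in>{1..s}. T' ! (2 * m - 1 - 1) \<in> W_shapes p (r - 1 - s + m) (m - 1) \<and>
                   T' ! (2 * m - 1) \<in> V_shapes p (r - 1 - s + m) m"
      and first: "\<exists>t\<in>{0..p - 2}. T' ! (2 - 1) = add_block (q * (p - 2 - t)) (q * t) (T' ! (1 - 1))"
      and rest: "\<forall>n\<in>{3..2 * s}. \<exists>t\<in>{0..p - 1}. T' ! (n - 1) =
             add_block (q * (p - 1 - t)) (q * t) (T' ! (n - 1 - 1))"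
      using T' unfolding SYT_V_def q if_not_P[OF s0] mem_Collect_eq by blast+
    have "\<exists>t\<le>block_size p i. T ! Suc i = add_block (q * (block_size p i - t)) (q * t) (T ! i)"
      if i: "i < 2 * s" for i
    proof -
      \<comment> \<open>Index 0 is the clause for the first block, the middle range is the clause
        for later blocks at \<open>n = i + 2\<close>, and the top index is the block appended by
        \<open>SYT_W\<close>.\<close>
      have "i = 0 \<or> 0 < i \<and> i < 2 * s - 1 \<or> i = 2 * s - 1 \<and> 0 < i"
        using i by linarith
      then consider "i = 0" | "0 < i" "i < 2 * s - 1" | "i = 2 * s - 1" "0 < i"
        by blast
      then show ?thesis
      proof cases
        case 1
        with first show ?thesis using len \<open>0 < s\<close> T by (auto simp: block_size_def nth_append)
      next
        case 2
        then have "i + 2 \<in> {3..2 * s}" by auto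
        from rest[rule_format, OF this] 2 show ?thesis using len T
          by (auto simp: block_size_def nth_append)
      next
        case 3
        with last show ?thesis using len lst T \<open>0 < s\<close> by (auto simp: block_size_def nth_append)
      qed
    qed
    moreover have "T ! (2 * m - 2) \<in> W_shapes p (r - 1 - s + m) (m - 1) \<and>
                   T ! (2 * m - 1) \<in> V_shapes p (r - 1 - s + m) m" if "m \<in> {1..s}" for m
    proof -
      have "T ! (2 * m - 2) = T' ! (2 * m - 1 - 1)" "T ! (2 * m - 1) = T' ! (2 * m - 1)"
        using that T len by (auto simp: nth_append eval_nat_numeral)
      then show ?thesis using shapes that by metis
    qed
    ultimately show ?R using T len by (auto simp: nth_append)
  next
    assume R: ?R
    define T' where "T' = butlast T"
    have T: "T = T' @ [h]"
      using R unfolding T'_def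
      by (metis append_butlast_last_id diff_Suc_1 last_conv_nth length_0_conv nat.simps(3))
    have len: "length T' = 2 * s" using R by (simp add: T'_def)
    have nth: "T' ! i = T ! i" if "i < 2 * s" for i using T len that by (simp add: nth_append)
    have shapes: "T' ! (2 * m - 1 - 1) \<in> W_shapes p (r - 1 - s + m) (m - 1) \<and>
                   T' ! (2 * m - 1) \<in> V_shapes p (r - 1 - s + m) m" if "m \<in> {1..s}" for m
    proof -
      have "T ! (2 * m - 2) = T' ! (2 * m - 1 - 1)" "T ! (2 * m - 1) = T' ! (2 * m - 1)"
        using that T len by (auto simp: nth_append eval_nat_numeral)
      then show ?thesis using R that by metis
    qed
    have step: "\<exists>t\<in>{0..block_size p i}. T ! Suc i = add_block (q * (block_size p i - t)) (q * t) (T ! i)"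
      if "i < 2 * s" for i using R that by (simp add: Bex_def)
    have "r - 1 - s + s = r - 1" using assms by simp
    then have h': "T' ! (2 * s - 1) \<in> V_shapes p (r - 1) s"
      using shapes[of s] \<open>0 < s\<close> by simp
    have first: "\<exists>t\<in>{0..p - 2}. T' ! (2 - 1) = add_block (q * (p - 2 - t)) (q * t) (T' ! (1 - 1))"
      using step[of 0] nth \<open>0 < s\<close> by (simp add: block_size_def)
    have rest: "\<exists>t\<in>{0..p - 1}. T' ! (n - 1) = add_block (q * (p - 1 - t)) (q * t) (T' ! (n - 1 - 1))"
      if "n \<in> {3..2 * s}" for n
    proof -
      define i where "i = n - 2"
      then have "n = i + 2" "0 < i" "Suc i < 2 * s"
        using that by auto
      then show ?thesis using step[of i] nth[of i] nth[of "Suc i"] by (simp add: block_size_def)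
    qed
    have last: "\<exists>t\<in>{0..p - 1}. h = add_block (q * (p - 1 - t)) (q * t) (T' ! (2 * s - 1))"
      using step[of "2 * s - 1"] nth[of "2 * s - 1"] R \<open>0 < s\<close> by (simp add: block_size_def)
    have "T' \<in> SYT_V p (r - 1) s (T' ! (2 * s - 1))"
      unfolding SYT_V_def q if_not_P[OF s0] mem_Collect_eq using len shapes first rest by blast
    then show "T \<in> SYT_W p r s h"
      using T h' last assms by (auto simp: SYT_W_def)
  qed
qed

section \<open>Digit sequences and tableaux correspond\<close>

lemma nth_tableau:
  "i \<le> 2 * s \<Longrightarrow> tableau p q s c d ! i = hook (hook_size p q i) (tableau_leg p q c d i)"
  unfolding tableau_def by (subst nth_map) (simp_all del: upt_Suc)

lemma length_tableau [simp]: "length (tableau p q s c d) = Suc (2 * s)"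
  by (simp add: tableau_def)

lemma tableau_leg_even: "tableau_leg p q c d (2 * m) = q * (leg_base p m + d m) + c"
  by (simp add: tableau_leg_def)

lemma tableau_leg_odd: "0 < m \<Longrightarrow> tableau_leg p q c d (2 * m - 1) = q * leg_base p m + c"
  by (simp add: tableau_leg_def Suc_diff_Suc)

text \<open>The leg of each added block is at most the size of the block, so the bound passes from
  entry to entry. It is what \<open>add_block_hook\<close> requires, as row lengths would otherwise
  be truncated at 0.\<close>

lemma tableau_leg_le_hook_size:
  assumes "p \<ge> 3" "c < q" "d 0 < p - 1" "\<And>m. 0 < m \<Longrightarrow> m \<le> s \<Longrightarrow> d m < p" "i \<le> 2 * s"
  shows "tableau_leg p q c d i \<le> hook_size p q i"
  using assms(5)
proof (induction i)
  case 0
  then show ?case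
    using add_mult_less[OF assms(2,3)] by (simp add: tableau_leg_def leg_base_def hook_size_def)
next
  case (Suc i)
  let ?t = "if even i then block_size p i - d (i div 2) else d (Suc i div 2)"
  have "?t \<le> block_size p i"
    using assms(4)[of "Suc i div 2"] Suc.prems by (auto simp: block_size_def elim!: oddE)
  then have "q * ?t \<le> q * block_size p i" by (rule mult_le_mono2)
  moreover have "tableau_leg p q c d (Suc i) = tableau_leg p q c d i + q * ?t"
    using Suc.prems assms by (intro tableau_leg_Suc) auto
  ultimately show ?case
    using Suc hook_size_Suc[OF assms(1), of q i] by linarith
qed

lemma tableau_step:
  assumes "p \<ge> 3" "c < q" "d 0 < p - 1" "\<And>m. 0 < m \<Longrightarrow> m \<le> s \<Longrightarrow> d m < p" "i < 2 * s"
  defines "t \<equiv> if even i then block_size p i - d (i div 2) else d (Suc i div 2)"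
  shows "t \<le> block_size p i" and "tableau p q s c d ! Suc i =
    add_block (q * (block_size p i - t)) (q * t) (tableau p q s c d ! i)"
proof -
  show t: "t \<le> block_size p i"
    using assms(4)[of "Suc i div 2"] \<open>i < 2 * s\<close> by (auto simp: block_size_def t_def elim!: oddE)
  have "tableau p q s c d ! Suc i =
      hook (hook_size p q i + q * block_size p i) (tableau_leg p q c d i + q * t)"
    using assms tableau_leg_Suc[of p d i q c] hook_size_Suc[OF assms(1), of q i] by (simp add: nth_tableau)
  also have "q * block_size p i = q * (block_size p i - t) + q * t"
    using t by (simp flip: add_mult_distrib2)
  finally show "tableau p q s c d ! Suc i =
      add_block (q * (block_size p i - t)) (q * t) (tableau p q s c d ! i)"
    using assms tableau_leg_le_hook_size[of p c q d s i]
    by (simp add: nth_tableau add_block_hook add.assoc)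
qed

text \<open>Rank and index grow together along a chain, so all its shapes have the same scale
  \<open>q\<close>.\<close>

lemma chain_shapes_eq:
  assumes "p \<ge> 3" "s \<le> r - 1" "q = p ^ (r - s - 1)" "m \<in> {1..s}"
  shows "W_shapes p (r - 1 - s + m) (m - 1) = {hook (hook_size p q (2 * (m - 1))) i | i.
      q * leg_base p (m - 1) \<le> i \<and> i < q * (leg_base p (m - 1) + leg_width p (m - 1))}"
    and "V_shapes p (r - 1 - s + m) m = {hook (hook_size p q (2 * m - 1)) i | i.
      q * leg_base p m \<le> i \<and> i < q * (leg_base p m + 1)}"
proof -
  have e: "r - 1 - s + m - (m - 1) - 1 = r - s - 1" "r - 1 - s + m - m = r - s - 1"
    "m - 1 \<le> r - 1 - s + m - 1" "0 < m"
    using assms by auto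
  show "W_shapes p (r - 1 - s + m) (m - 1) = {hook (hook_size p q (2 * (m - 1))) i | i.
      q * leg_base p (m - 1) \<le> i \<and> i < q * (leg_base p (m - 1) + leg_width p (m - 1))}"
    by (rule W_shapes_eq) (simp_all only: assms e)
  show "V_shapes p (r - 1 - s + m) m = {hook (hook_size p q (2 * m - 1)) i | i.
      q * leg_base p m \<le> i \<and> i < q * (leg_base p m + 1)}"
    by (rule V_shapes_eq) (simp_all only: assms e)
qed

lemma tableau_in_SYT_W:
  assumes "p \<ge> 3" "0 < s" "s \<le> r - 1" "q = p ^ (r - s - 1)"
    and "c < q" "d 0 < p - 1" "\<And>m. 0 < m \<Longrightarrow> m \<le> s \<Longrightarrow> d m < p"
  shows "tableau p q s c d \<in>
    SYT_W p r s (hook (hook_size p q (2 * s)) (q * (leg_base p s + d s) + c))"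
proof -
  let ?T = "tableau p q s c d"
  have width: "d m < leg_width p m" if "m \<le> s" for m
    using that assms by (auto simp: leg_width_def)
  have "?T ! (2 * m - 2) \<in> W_shapes p (r - 1 - s + m) (m - 1) \<and>
        ?T ! (2 * m - 1) \<in> V_shapes p (r - 1 - s + m) m" if m: "m \<in> {1..s}" for m
  proof
    obtain m' where "m = Suc m'" using m by (cases m) auto
    then have "?T ! (2 * m - 2) =
        hook (hook_size p q (2 * (m - 1))) (c + q * (leg_base p (m - 1) + d (m - 1)))"
      using m by (simp add: nth_tableau tableau_leg_even add.commute)
    then show "?T ! (2 * m - 2) \<in> W_shapes p (r - 1 - s + m) (m - 1)"
      using add_mult_less[of c q "leg_base p (m - 1) + d (m - 1)"
          "leg_base p (m - 1) + leg_width p (m - 1)"] width[of "m - 1"] m assms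
      unfolding chain_shapes_eq(1)[OF assms(1,3,4) m] by (auto simp: add_mult_distrib2)
    have "?T ! (2 * m - 1) = hook (hook_size p q (2 * m - 1)) (c + q * leg_base p m)"
      using m tableau_leg_odd[of m p q c d] nth_tableau[of "2 * m - 1" s p q c d]
      by (auto simp add: add.commute)
    then show "?T ! (2 * m - 1) \<in> V_shapes p (r - 1 - s + m) m"
      using \<open>c < q\<close> unfolding chain_shapes_eq(2)[OF assms(1,3,4) m] by (auto simp: add_mult_distrib2)
  qed
  moreover have "\<exists>t\<le>block_size p i. ?T ! Suc i = add_block (q * (block_size p i - t)) (q * t) (?T ! i)"
    if "i < 2 * s" for i
    using tableau_step[where p = p and c = c and q = q and d = d and s = s and i = i] assms that by blast
  ultimately show ?thesis
    using assms by (subst SYT_W_iff) (auto simp: nth_tableau tableau_leg_even)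
qed

text \<open>Block legs are multiples of \<open>q\<close>, so all legs share one residue
  \<open>c\<close>. The quotient is forced at \<open>V\<close>-shapes and leaves a digit at
  \<open>W\<close>-shapes; membership of \<open>h\<close> in \<open>W_shapes\<close> supplies the
  range of the last digit.\<close>

lemma SYT_W_tableau:
  assumes "p \<ge> 3" "0 < s" "s \<le> r - 1" "q = p ^ (r - s - 1)"
    and "T \<in> SYT_W p r s h" "h \<in> W_shapes p r s"
  obtains c d where "c < q" "d 0 < p - 1" "\<And>m. 0 < m \<Longrightarrow> m \<le> s \<Longrightarrow> d m < p"
    and "T = tableau p q s c d"
proof -
  have T: "length T = Suc (2 * s)" "T ! (2 * s) = h"
    "\<And>m. m \<in> {1..s} \<Longrightarrow> T ! (2 * m - 2) \<in> W_shapes p (r - 1 - s + m) (m - 1)"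
    "\<And>m. m \<in> {1..s} \<Longrightarrow> T ! (2 * m - 1) \<in> V_shapes p (r - 1 - s + m) m"
    "\<And>i. i < 2 * s \<Longrightarrow> \<exists>t\<le>block_size p i.
       T ! Suc i = add_block (q * (block_size p i - t)) (q * t) (T ! i)"
    using assms(5) unfolding SYT_W_iff[OF assms(1-4)] by blast+
  have q: "q > 0" using assms by simp
  define f where "f i = leg (T ! i)" for i
  have even: "T ! (2 * m) = hook (hook_size p q (2 * m)) (f (2 * m))"
    "q * leg_base p m \<le> f (2 * m)" "f (2 * m) < q * (leg_base p m + leg_width p m)"
    if "m \<le> s" for m
  proof -
    have "T ! (2 * m) \<in> {hook (hook_size p q (2 * m)) i | i.
      q * leg_base p m \<le> i \<and> i < q * (leg_base p m + leg_width p m)}"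
    proof (cases "m = s")
      case True
      with assms T(2) W_shapes_eq[OF assms(1,3,4)] show ?thesis by simp
    next
      case False
      then have "Suc m \<in> {1..s}" using that by simp
      from T(3)[OF this] chain_shapes_eq(1)[OF assms(1,3,4) this] show ?thesis by simp
    qed
    then show "T ! (2 * m) = hook (hook_size p q (2 * m)) (f (2 * m))"
      "q * leg_base p m \<le> f (2 * m)" "f (2 * m) < q * (leg_base p m + leg_width p m)"
      unfolding f_def by auto
  qed
  have odd: "T ! (2 * m - 1) = hook (hook_size p q (2 * m - 1)) (f (2 * m - 1))"
    "q * leg_base p m \<le> f (2 * m - 1)" "f (2 * m - 1) < q * (leg_base p m + 1)"
    if "m \<in> {1..s}" for m
    using T(4)[OF that] unfolding chain_shapes_eq(2)[OF assms(1,3,4) that] f_def by auto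
  \<comment> \<open>Each entry has the form of a hook, so the leg of the added block simply adds to
    the previous leg.\<close>
  have hook: "\<exists>k. T ! i = hook k (f i)" if "i \<le> 2 * s" for i
  proof (cases "even i")
    case True
    then show ?thesis using even(1)[of "i div 2"] that by auto
  next
    case False
    then obtain m where "i = 2 * Suc m - 1" by (auto elim!: oddE)
    then show ?thesis using odd(1)[of "Suc m"] that by auto
  qed
  define c where "c = f 0 mod q"
  have mod: "f i mod q = c" if "i \<le> 2 * s" for i
    using that
  proof (induction i)
    case (Suc i)
    obtain t where "T ! Suc i = add_block (q * (block_size p i - t)) (q * t) (T ! i)"
      using T(5)[of i] Suc.prems by auto
    moreover obtain k where "T ! i = hook k (f i)" using hook[of i] Suc.prems by auto
    ultimately have "f (Suc i) = leg (hook k (f i)) + q * t"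
      unfolding f_def[of "Suc i"] by (simp only: leg_add_block_hook leg_hook)
    then show ?case using Suc by simp
  qed (simp add: c_def)
  define d where "d m = f (2 * m) div q - leg_base p m" for m
  have c: "c < q" using q by (simp add: c_def)
  have d: "f (2 * m) = q * (leg_base p m + d m) + c" "d m < leg_width p m" if "m \<le> s" for m
  proof -
    have "leg_base p m \<le> f (2 * m) div q"
      using even(2)[OF that] q by (simp add: less_eq_div_iff_mult_less_eq mult.commute)
    then have div: "f (2 * m) div q = leg_base p m + d m" by (simp add: d_def)
    then show "f (2 * m) = q * (leg_base p m + d m) + c"
      using mult_div_mod_eq[of q "f (2 * m)"] mod[of "2 * m"] that by simp
    have "f (2 * m) div q < leg_base p m + leg_width p m"
      using even(3)[OF that] by (simp add: less_mult_imp_div_less mult.commute)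
    with div show "d m < leg_width p m" by simp
  qed
  have odd_leg: "f (2 * m - 1) = q * leg_base p m + c" if "m \<in> {1..s}" for m
  proof -
    have "f (2 * m - 1) div q = leg_base p m"
      using odd(2,3)[OF that] by (intro div_nat_eqI) (simp_all add: mult.commute)
    moreover have "f (2 * m - 1) mod q = c" using that by (intro mod) auto
    ultimately show ?thesis by (metis mult_div_mod_eq)
  qed
  have "T = tableau p q s c d"
  proof (rule nth_equalityI)
    fix i assume "i < length T"
    then have i: "i \<le> 2 * s" using T by simp
    show "T ! i = tableau p q s c d ! i"
    proof (cases "even i")
      case True
      then obtain m where "i = 2 * m" by blast
      then show ?thesis using even(1)[of m] d(1)[of m] i
        by (simp add: nth_tableau tableau_leg_even)
    next
      case False
      then obtain m where m: "i = 2 * Suc m - 1" by (auto elim!: oddE)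
      then have "Suc m \<in> {1..s}" using i by simp
      from odd(1)[OF this] odd_leg[OF this] show ?thesis
        unfolding m using i m by (simp only: nth_tableau tableau_leg_odd)
    qed
  qed (use T in simp)
  moreover have "d 0 < p - 1" "\<And>m. 0 < m \<Longrightarrow> m \<le> s \<Longrightarrow> d m < p"
    using d(2)[of 0] d(2) by (simp_all add: leg_width_def) (metis less_numeral_extra(3))
  ultimately show thesis using that c by blast
qed

section \<open>The number of a tableau\<close>

text \<open>The scale is existentially quantified in \<open>block_type_has_number\<close>. Comparing
  total block sizes forces it to be \<open>q\<close>, after which the leg determines
  \<open>m\<close> and the case.\<close>

lemma block_type_number_unique:
  assumes "odd p" "p \<ge> 3" "q > 0" "t \<le> p - 1" "block_type_has_number p (q * (p - 1 - t)) (q * t) n"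
  shows "n = zigzag p t + 1"
proof -
  obtain h where h: "p = 2 * h + 1" "h > 0" using assms by (auto elim!: oddE)
  obtain m q' where m: "m \<le> h"
    and *: "q * (p - 1 - t) = q' * h + q' * m \<and> q * t = q' * h - q' * m \<and> n = 2 * m + 1 \<or>
      1 \<le> m \<and> q * (p - 1 - t) = q' * h - q' * m \<and> q * t = q' * h + q' * m \<and> n = 2 * m"
    using assms(5) h by (auto simp: block_type_has_number_def)
  have le: "q' * m \<le> q' * h" using m by simp
  have "q * (p - 1) = q * (p - 1 - t) + q * t"
    using assms(4) by (metis add_mult_distrib2 le_add_diff_inverse2)
  also have "\<dots> = q' * (p - 1)" using * le h by auto
  finally have q: "q' = q" using h by simp
  have "t = h - m \<and> n = 2 * m + 1 \<or> 1 \<le> m \<and> t = h + m \<and> n = 2 * m"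
    using * \<open>q > 0\<close> unfolding q by (auto simp flip: add_mult_distrib2 diff_mult_distrib2)
  then show ?thesis using m h by (auto simp: zigzag_def)
qed

text \<open>The witness \<open>m\<close> is the distance from \<open>t\<close> to
  \<open>(p - 1) div 2\<close>; the side on which \<open>t\<close> lies decides between an odd and
  an even number.\<close>

lemma block_type_number:
  assumes "odd p" "p \<ge> 3" "q = p ^ e" "t \<le> p - 1"
  shows "block_type_has_number p (q * (p - 1 - t)) (q * t) (zigzag p t + 1)"
proof -
  obtain h where h: "p = 2 * h + 1" using assms by (auto elim!: oddE)
  show ?thesis
  proof (cases "t \<le> h")
    case True
    show ?thesis unfolding block_type_has_number_def
      by (rule exI[of _ e], rule exI[of _ "h - t"], rule exI[of _ q])
        (use True assms(3) h in \<open>simp add: zigzag_def flip: add_mult_distrib2 diff_mult_distrib2\<close>)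
  next
    case False
    show ?thesis unfolding block_type_has_number_def
      by (rule exI[of _ e], rule exI[of _ "t - h"], rule exI[of _ q])
        (use False assms(3,4) h in \<open>simp add: zigzag_def flip: add_mult_distrib2 diff_mult_distrib2\<close>, auto)
  qed
qed

lemma step_number_add_block:
  assumes "odd p" "p \<ge> 3" "q = p ^ e" "t \<le> p - 1"
  shows "step_number p h (add_block (q * (p - 1 - t)) (q * t) h) = zigzag p t + 1"
  unfolding step_number_def
proof (rule the_equality)
  show "\<exists>a b. add_block (q * (p - 1 - t)) (q * t) h = add_block a b h \<and>
      block_type_has_number p a b (zigzag p t + 1)"
    using block_type_number[OF assms] by blast
next
  fix n assume "\<exists>a b. add_block (q * (p - 1 - t)) (q * t) h = add_block a b h \<and>
      block_type_has_number p a b n"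
  then show "n = zigzag p t + 1"
    using block_type_number_unique[of p q t n] assms by (auto simp: add_block_inject)
qed

text \<open>The number \<open>i\<^sub>n\<close> belongs to the step from entry
  \<open>2 * (s - n)\<close> to the next \<open>V\<close>-shape, whose block leg is the complement
  of the digit \<open>d (s - n)\<close>. Since \<open>n < s\<close>, this is never the smaller first
  block.\<close>

lemma block_idx_tableau:
  assumes "odd p" "p \<ge> 3" "q = p ^ e" "c < q" "d 0 < p - 1"
    and "\<And>m. 0 < m \<Longrightarrow> m \<le> s \<Longrightarrow> d m < p" and "0 < n" "n < s"
  shows "block_idx p s (butlast (tableau p q s c d)) n = zigzag p (p - 1 - d (s - n)) + 1"
proof -
  let ?T = "tableau p q s c d"
  define m where "m = s - n"
  have m: "0 < m" "m < s" using assms by (auto simp: m_def)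
  have "2 * (m + 1) - 1 - 1 = 2 * m" "2 * (m + 1) - 1 = Suc (2 * m)" by simp_all
  moreover have "butlast ?T ! (2 * m) = ?T ! (2 * m)" "butlast ?T ! Suc (2 * m) = ?T ! Suc (2 * m)"
    using m by (simp_all add: nth_butlast)
  moreover have "?T ! Suc (2 * m) =
      add_block (q * (p - 1 - (p - 1 - d m))) (q * (p - 1 - d m)) (?T ! (2 * m))"
    using tableau_step(2)[of p c q d s "2 * m"] assms m by (simp add: block_size_def)
  ultimately show ?thesis
    using step_number_add_block[OF assms(1-3), of "p - 1 - d m"]
    by (simp only: block_idx_def m_def[symmetric] diff_le_self)
qed

text \<open>Here \<open>e n\<close> is \<open>i\<^sub>n - 1\<close> with \<open>n\<close> shifted
  down by one. For \<open>s = r - 1\<close> the first hook supplies the top digit. Otherwise it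
  supplies the lowest digit, of radix \<open>p - 1\<close>, and the remaining digits are rotated
  because \<open>i\<^sub>1\<close> carries the highest weight.\<close>

lemma number_W_tableau:
  assumes "odd p" "p \<ge> 3" "0 < s" "s \<le> r - 1" "q = p ^ (r - s - 1)"
    and "c < q" "d 0 < p - 1" "\<And>m. 0 < m \<Longrightarrow> m \<le> s \<Longrightarrow> d m < p"
  defines "e \<equiv> \<lambda>n. zigzag p (p - 1 - d (s - 1 - n))"
  shows "number_W p r s (tableau p q s c d) =
    1 + (if s = r - 1 then (\<Sum>n<s - 1. p ^ n * e n) + p ^ (s - 1) * (first_idx p (d 0) - 1)
         else d 0 + (p - 1) * (\<Sum>n<s - 1. p ^ n * e (if n = s - 2 then 0 else Suc n)))"
proof -
  let ?T = "butlast (tableau p q s c d)"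
  have idx: "block_idx p s ?T n = e (n - 1) + 1" if "0 < n" "n < s" for n
    using block_idx_tableau[where d = d, OF assms(1,2,5-8) that] that by (simp add: e_def)
  have leg: "leg (?T ! (1 - 1)) = q * d 0 + c"
    using assms tableau_leg_even[of p q c d 0]
    by (simp add: nth_butlast nth_tableau leg_base_def)
  show ?thesis
  proof (cases "s = r - 1")
    case True
    \<comment> \<open>In this case \<open>q = 1\<close>, so \<open>c = 0\<close> and the first leg
      is itself a digit.\<close>
    then have "leg (?T ! (1 - 1)) = d 0" using leg assms by simp
    define i where "i n = (if n = s then first_idx p (d 0) else block_idx p s ?T n)" for n
    obtain s' where s: "s = Suc s'" using \<open>0 < s\<close> gr0_implies_Suc by blast
    have "number_W p r s (tableau p q s c d) = i 1 + (\<Sum>n = 2..s. p ^ (n - 1) * (i n - 1))"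
      unfolding number_W_def number_V_def Let_def \<open>leg (?T ! (1 - 1)) = d 0\<close>
      using True by (simp add: i_def)
    \<comment> \<open>As \<open>i 1\<close> is at least 1, it splits into the leading 1 and the term
      of weight 1 missing from the sum that starts at 2.\<close>
    also have "i 1 = 1 + p ^ (1 - 1) * (i 1 - 1)"
      using idx[of 1] first_idx_pos[OF assms(7)] \<open>0 < s\<close> by (cases "s = 1") (auto simp: i_def)
    also have "\<dots> + (\<Sum>n = 2..s. p ^ (n - 1) * (i n - 1)) = 1 + (\<Sum>n = 1..s. p ^ (n - 1) * (i n - 1))"
      using \<open>0 < s\<close> by (simp add: sum.atLeast_Suc_atMost numeral_2_eq_2)
    also have "(\<Sum>n = 1..s. p ^ (n - 1) * (i n - 1)) = (\<Sum>n<s. p ^ n * (i (Suc n) - 1))"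
      by (simp add: sum.atLeast1_atMost_eq)
    also have "\<dots> = (\<Sum>n<s'. p ^ n * e n) + p ^ s' * (first_idx p (d 0) - 1)"
      using idx by (simp add: s i_def)
    finally show ?thesis unfolding if_P[OF True] by (simp add: s)
  next
    case False
    have "p ^ (r - 1 - s) = q" using assms(5) by simp
    then have u: "leg (?T ! (1 - 1)) div p ^ (r - 1 - s) = d 0"
      using assms(6) unfolding leg by simp
    have *: "number_W p r s (tableau p q s c d) =
      (if s > 1
       then 1 + d 0 + p ^ (s - 2) * (p - 1) * (block_idx p s ?T 1 - 1)
                 + (\<Sum>n = 1..s - 2. p ^ (n - 1) * (p - 1) * (block_idx p s ?T (n + 1) - 1))
            else 1 + d 0)"
      unfolding number_W_def number_V_def Let_def if_not_P[OF False] u ..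
    show ?thesis
    proof (cases "s > 1")
      case True
      define s' where "s' = s - 2"
      then have s: "s = Suc (Suc s')" using True by simp
      have "(\<Sum>n = 1..s'. p ^ (n - 1) * (p - 1) * (block_idx p s ?T (n + 1) - 1)) =
          (p - 1) * (\<Sum>n<s'. p ^ n * e (Suc n))"
        unfolding sum_distrib_left One_nat_def sum.atLeast1_atMost_eq
        using idx s by (intro sum.cong) simp_all
      then show ?thesis using * idx[of 1] False
        by (simp add: s distrib_left ac_simps)
    qed (use * False \<open>0 < s\<close> in simp)
  qed
qed

section \<open>Range and injectivity of the numbering, and the count of tableaux of one
  shape\<close>

lemma number_W_range:
  assumes "odd p" "p \<ge> 3" "0 < s" "s \<le> r - 1" "T \<in> SYT_W p r s h" "h \<in> W_shapes p r s"
  shows "number_W p r s T \<in> {1..p ^ (s - 1) * (p - 1)}"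
proof -
  obtain c d where cd: "c < p ^ (r - s - 1)" "d 0 < p - 1" "\<And>m. 0 < m \<Longrightarrow> m \<le> s \<Longrightarrow> d m < p"
    and T: "T = tableau p (p ^ (r - s - 1)) s c d"
    using SYT_W_tableau[OF assms(2-4) refl assms(5,6)] by blast
  have e: "(\<Sum>n<s - 1. p ^ n * zigzag p (f n)) < p ^ (s - 1)" if "\<And>n. f n < p" for f
    using that assms by (intro digit_sum_less zigzag_less)
  have "first_idx p (d 0) - 1 < p - 1"
    using first_idx_le[OF assms(1) cd(2)] assms by simp
  note bounds = add_mult_less[OF e this] add_mult_less[OF cd(2) e]
  define S where "S f = (\<Sum>n<s - 1. p ^ n * zigzag p (p - 1 - d (s - 1 - f n)))" for f
  have "S (\<lambda>n. n) + p ^ (s - 1) * (first_idx p (d 0) - 1) < p ^ (s - 1) * (p - 1)"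
    "d 0 + (p - 1) * S (\<lambda>n. if n = s - 2 then 0 else Suc n) < p ^ (s - 1) * (p - 1)"
    unfolding S_def using bounds assms(2) by (simp_all add: mult.commute)
  then show ?thesis
    using number_W_tableau[where d = d, OF assms(1-4) refl cd] unfolding T S_def[symmetric]
    by (cases "s = r - 1") (simp_all only: if_True if_False, auto)
qed

text \<open>The common shape fixes \<open>c\<close> and the last digit \<open>d s\<close>, neither
  of which enters the number. All earlier digits are recovered from the mixed-radix
  expansion.\<close>

lemma number_W_inj_on:
  assumes "odd p" "p \<ge> 3" "0 < s" "s \<le> r - 1" "h \<in> W_shapes p r s"
  shows "inj_on (number_W p r s) (SYT_W p r s h)"
proof (rule inj_onI)
  fix T T' assume TT: "T \<in> SYT_W p r s h" "T' \<in> SYT_W p r s h"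
    and eq: "number_W p r s T = number_W p r s T'"
  define q where "q = p ^ (r - s - 1)"
  obtain c d where cd: "c < q" "d 0 < p - 1" "\<And>m. 0 < m \<Longrightarrow> m \<le> s \<Longrightarrow> d m < p"
    and T: "T = tableau p q s c d"
    using SYT_W_tableau[OF assms(2-4) q_def TT(1) assms(5)] by blast
  obtain c' d' where cd': "c' < q" "d' 0 < p - 1" "\<And>m. 0 < m \<Longrightarrow> m \<le> s \<Longrightarrow> d' m < p"
    and T': "T' = tableau p q s c' d'"
    using SYT_W_tableau[OF assms(2-4) q_def TT(2) assms(5)] by blast
  have "T ! (2 * s) = T' ! (2 * s)"
    using TT unfolding SYT_W_iff[OF assms(2-4) q_def] by simp
  then have "c + q * (leg_base p s + d s) = c' + q * (leg_base p s + d' s)"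
    by (auto simp: T T' nth_tableau tableau_leg_even dest!: hook_inject)
  from add_mult_inj[OF this cd(1) cd'(1)] have cs: "c = c'" "d s = d' s" by simp_all
  define e where "e n = zigzag p (p - 1 - d (s - 1 - n))" for n
  define e' where "e' n = zigzag p (p - 1 - d' (s - 1 - n))" for n
  have e: "e n < p" "e' n < p" for n
    using assms unfolding e_def e'_def by (simp_all add: zigzag_less)
  define R where "R n = (if n = s - 2 then 0 else Suc n)" for n
  have num: "(if s = r - 1 then (\<Sum>n<s - 1. p ^ n * e n) + p ^ (s - 1) * (first_idx p (d 0) - 1)
         else d 0 + (p - 1) * (\<Sum>n<s - 1. p ^ n * e (R n))) =
     (if s = r - 1 then (\<Sum>n<s - 1. p ^ n * e' n) + p ^ (s - 1) * (first_idx p (d' 0) - 1)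
         else d' 0 + (p - 1) * (\<Sum>n<s - 1. p ^ n * e' (R n)))"
    using eq number_W_tableau[where d = d, OF assms(1-4) q_def cd] number_W_tableau[where d = d', OF assms(1-4) q_def cd']
    unfolding T T' e_def e'_def R_def by simp
  have "d 0 = d' 0 \<and> (\<forall>n<s - 1. e n = e' n)"
  proof (cases "s = r - 1")
    case True
    then have "(\<Sum>n<s - 1. p ^ n * e n) = (\<Sum>n<s - 1. p ^ n * e' n) \<and>
        first_idx p (d 0) - 1 = first_idx p (d' 0) - 1"
      using num e by (intro add_mult_inj[where m = "p ^ (s - 1)"] digit_sum_less) simp_all
    moreover from this have "e n = e' n" if "n < s - 1" for n
      using digit_sum_inj[of "s - 1" e p e' n] e that by blast
    moreover have "first_idx p (d 0) = first_idx p (d' 0) \<Longrightarrow> d 0 = d' 0"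
      using first_idx_inj cd(2) cd'(2) by blast
    ultimately show ?thesis
      using first_idx_pos[OF cd(2)] first_idx_pos[OF cd'(2)] by (metis le_add_diff_inverse)
  next
    case False
    then have *: "d 0 = d' 0 \<and> (\<Sum>n<s - 1. p ^ n * e (R n)) = (\<Sum>n<s - 1. p ^ n * e' (R n))"
      using num cd(2) cd'(2) by (intro add_mult_inj[where m = "p - 1"]) simp_all
    have "e n = e' n" if n: "n < s - 1" for n
    proof -
      \<comment> \<open>The inverse of the rotation \<open>R\<close>: the position at which the
        expansion carries the digit \<open>e n\<close>.\<close>
      define k where "k = (if n = 0 then s - 2 else n - 1)"
      have "k < s - 1" "R k = n" using n by (auto simp: k_def R_def)
      with digit_sum_inj[of "s - 1" "\<lambda>n. e (R n)" p "\<lambda>n. e' (R n)" k] * e show ?thesis by auto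
    qed
    with * show ?thesis by blast
  qed
  note d0 = this
  have "d m = d' m" if "m \<le> s" for m
  proof (cases "m = 0 \<or> m = s")
    case False
    then have m: "0 < m" "m < s" using that by auto
    then have "e (s - 1 - m) = e' (s - 1 - m)" using d0 by simp
    then have "p - 1 - d m = p - 1 - d' m"
      using m by (auto simp: e_def e'_def dest: zigzag_inj)
    moreover have "d m < p" "d' m < p" using cd(3)[of m] cd'(3)[of m] m by auto
    ultimately show ?thesis by linarith
  qed (use d0 cs in auto)
  then show "T = T'"
    unfolding T T' using cs by (intro nth_equalityI) (auto simp: nth_tableau tableau_leg_def)
qed

text \<open>The injective numbering bounds the count from above. From below, the shape fixes
  \<open>c\<close> and the last digit \<open>k\<close>, and every choice of the remaining digits
  gives a different tableau.\<close>

lemma card_SYT_W: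
  assumes "odd p" "p \<ge> 3" "0 < s" "s \<le> r - 1" "h \<in> W_shapes p r s"
  shows "card (SYT_W p r s h) = p ^ (s - 1) * (p - 1)"
proof (rule antisym)
  have sub: "number_W p r s ` SYT_W p r s h \<subseteq> {1..p ^ (s - 1) * (p - 1)}"
    using number_W_range[OF assms(1-4) _ assms(5)] by blast
  then show "card (SYT_W p r s h) \<le> p ^ (s - 1) * (p - 1)"
    using card_inj_on_le[OF number_W_inj_on[OF assms] sub] by simp
  have fin: "finite (SYT_W p r s h)"
    using inj_on_finite[OF number_W_inj_on[OF assms] sub] by simp
  define q where "q = p ^ (r - s - 1)"
  have "q > 0" using assms by (simp add: q_def)
  obtain x where h: "h = hook (hook_size p q (2 * s)) x"
    and x: "q * leg_base p s \<le> x" "x < q * (leg_base p s + leg_width p s)"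
    using assms(5) unfolding W_shapes_eq[OF assms(2,4) q_def] by blast
  define c where "c = x mod q"
  define k where "k = x div q - leg_base p s"
  have "c < q" using \<open>q > 0\<close> by (simp add: c_def)
  have "leg_base p s \<le> x div q"
    using x(1) \<open>q > 0\<close> by (simp add: less_eq_div_iff_mult_less_eq mult.commute)
  then have xk: "x = q * (leg_base p s + k) + c"
    by (simp add: k_def c_def)
  have "x div q < leg_base p s + leg_width p s"
    using x(2) by (simp add: less_mult_imp_div_less mult.commute)
  then have k: "k < p" using \<open>leg_base p s \<le> x div q\<close> \<open>0 < s\<close> by (simp add: k_def leg_width_def)
  \<comment> \<open>The free digits: one of width \<open>p - 1\<close> and \<open>s - 1\<close> of
    width \<open>p\<close>.\<close>
  define D where "D = (\<Pi>\<^sub>E m\<in>{..<s}. {..<leg_width p m})"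
  define F where "F d = tableau p q s c (d(s := k))" for d
  have "F ` D \<subseteq> SYT_W p r s h"
  proof
    fix T assume "T \<in> F ` D"
    then obtain d where d: "d \<in> D" "T = F d" by blast
    have dm: "d m < leg_width p m" if "m < s" for m
      using d(1) that by (auto simp: D_def PiE_iff)
    have "tableau p q s c (d(s := k)) \<in>
      SYT_W p r s (hook (hook_size p q (2 * s)) (q * (leg_base p s + (d(s := k)) s) + c))"
    proof (rule tableau_in_SYT_W[OF assms(2-4) q_def \<open>c < q\<close>])
      show "(d(s := k)) 0 < p - 1" using dm[of 0] \<open>0 < s\<close> by (simp add: leg_width_def)
      show "(d(s := k)) m < p" if "0 < m" "m \<le> s" for m
        using dm[of m] that k by (simp add: leg_width_def)
    qed
    then show "T \<in> SYT_W p r s h" using d(2) h xk by (simp add: F_def)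
  qed
  moreover have "inj_on F D"
  proof (rule inj_onI)
    fix d d' assume d: "d \<in> D" "d' \<in> D" "F d = F d'"
    have "d m = d' m" if "m < s" for m
    proof -
      have "F d ! (2 * m) = F d' ! (2 * m)" using d by simp
      then have "leg (F d ! (2 * m)) = leg (F d' ! (2 * m))" by simp
      then show ?thesis using that \<open>q > 0\<close> by (simp add: F_def nth_tableau tableau_leg_even)
    qed
    with d(1,2) show "d = d'" unfolding D_def by (intro PiE_ext[of d "{..<s}" _ d']) auto
  qed
  ultimately have "card D \<le> card (SYT_W p r s h)"
    using fin by (intro card_inj_on_le)
  moreover have "card D = p ^ (s - 1) * (p - 1)"
  proof -
    obtain s' where s: "s = Suc s'" using \<open>0 < s\<close> gr0_implies_Suc by blast
    show ?thesis
      by (simp add: D_def card_PiE s prod.lessThan_Suc_shift leg_width_def mult.commute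
          del: prod.lessThan_Suc)
  qed
  ultimately show "p ^ (s - 1) * (p - 1) \<le> card (SYT_W p r s h)" by simp
qed

section \<open>The integer l\<close>

lemma nu_eq_zigzag:
  assumes "p = 2 * h + 1" "\<epsilon> \<in> {1, -1}" "j \<le> h"
  shows "nu \<epsilon> j = zigzag p (nat (int h + \<epsilon> * int j))"
    and "nat (int h + \<epsilon> * int j) < p"
  using assms by (auto simp: nu_def zigzag_def nat_diff_distrib' nat_add_distrib)

text \<open>All base-\<open>p\<close> digits of \<open>(k - 1) div 2 - q * leg_base p s\<close>
  equal \<open>(p - 1) div 2\<close>. Adding this constant to each signed digit turns the balanced
  expansion of the leg into the ordinary one, whose uniqueness makes the description of
  \<open>l\<close> definite.\<close>

lemma l_of_eq:
  assumes "odd p" "p \<ge> 3" "0 < s" "s \<le> r - 1" "q = p ^ (r - s - 1)"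
    and leg: "leg h = q * leg_base p s + (\<Sum>i<r - s. p ^ i * \<delta> i)"
    and \<delta>: "\<And>i. i < r - s \<Longrightarrow> \<delta> i < p"
  shows "l_of p r s h = (p - 1) * (\<Sum>i<r - s. p ^ i * zigzag p (\<delta> i))"
proof -
  obtain H where H: "p = 2 * H + 1" using \<open>odd p\<close> by (auto elim!: oddE)
  define n where "n = r - s"
  \<comment> \<open>In \<open>l_of\<close> the digit with index \<open>i\<close> has weight
    \<open>p ^ (n - i)\<close>; the reflection restores increasing weights from 0.\<close>
  have rev: "(\<Sum>i = 1..n. F i) = (\<Sum>i<n. F (n - i))" for F :: "nat \<Rightarrow> 'z :: comm_monoid_add"
    by (rule sum.reindex_bij_witness[where i = "\<lambda>i. n - i" and j = "\<lambda>i. n - i"]) auto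
  have gp: "2 * (\<Sum>i<m. p ^ i * H) + 1 = p ^ m" for m
    by (induction m) (simp_all add: H algebra_simps)
  have "(q * ((2 * s + 1) * p - 2 * (s + 1)) - 1) div 2 = q * leg_base p s + (\<Sum>i<n. p ^ i * H)"
  proof -
    have "(2 * s + 1) * p - 2 * (s + 1) = 2 * leg_base p s + p"
      using assms(2,3) H by (cases s) (simp_all add: leg_base_def algebra_simps)
    moreover have "q * p = p ^ n"
    proof -
      have "n = Suc (r - s - 1)" using assms by (simp add: n_def)
      then show ?thesis using assms(5) by simp
    qed
    ultimately have "q * ((2 * s + 1) * p - 2 * (s + 1)) =
        2 * (q * leg_base p s + (\<Sum>i<n. p ^ i * H)) + 1"
      using gp[of n] by (simp add: algebra_simps)
    then show ?thesis by simp
  qed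
  note half = this
  have *: "int (leg h) = int ((q * ((2 * s + 1) * p - 2 * (s + 1)) - 1) div 2) +
        (\<Sum>i = 1..n. \<epsilon> i * int (p ^ (n - i)) * int (j i)) \<longleftrightarrow>
      (\<Sum>i<n. int (p ^ i) * int (\<delta> i)) =
      (\<Sum>i<n. int (p ^ i) * (int H + \<epsilon> (n - i) * int (j (n - i))))" for \<epsilon> j
  proof -
    have "(\<Sum>i = 1..n. \<epsilon> i * int (p ^ (n - i)) * int (j i)) =
        (\<Sum>i<n. int (p ^ i) * (\<epsilon> (n - i) * int (j (n - i))))"
      unfolding rev by (intro sum.cong) (auto simp: mult_ac)
    then show ?thesis
      unfolding half leg n_def[symmetric] by (simp add: sum.distrib distrib_left)
  qed
  have l: "(\<Sum>i = 1..n. p ^ (n - i) * nu (\<epsilon> i) (j i)) =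
      (\<Sum>i<n. p ^ i * zigzag p (nat (int H + \<epsilon> (n - i) * int (j (n - i)))))"
    if "\<forall>i\<in>{1..n}. \<epsilon> i \<in> {1, -1} \<and> j i \<le> (p - 1) div 2" for \<epsilon> j
    unfolding rev using that H by (intro sum.cong) (auto simp: nu_eq_zigzag(1)[OF H] simp del: insert_iff)
  show ?thesis
    unfolding l_of_def Let_def assms(5)[symmetric] unfolding n_def[symmetric] *
  proof (rule the_equality)
    \<comment> \<open>Signed digits are distances from \<open>H\<close>. A zero digit receives the
      sign -1, which \<open>nu\<close> ignores.\<close>
    define \<epsilon> where "\<epsilon> i = (if \<delta> (n - i) \<le> H then -1 else 1 :: int)" for i
    define j where "j i = (if \<delta> (n - i) \<le> H then H - \<delta> (n - i) else \<delta> (n - i) - H)" for i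
    have 1: "\<forall>i\<in>{1..n}. \<epsilon> i \<in> {1, -1} \<and> j i \<le> (p - 1) div 2"
    proof
      fix i assume "i \<in> {1..n}"
      then have "\<delta> (n - i) < p" using \<delta>[of "n - i"] by (auto simp: n_def)
      then show "\<epsilon> i \<in> {1, -1} \<and> j i \<le> (p - 1) div 2" using H by (auto simp: \<epsilon>_def j_def)
    qed
    moreover have 2: "int H + \<epsilon> (n - i) * int (j (n - i)) = int (\<delta> i)" if "i < n" for i
      using that by (simp add: \<epsilon>_def j_def of_nat_diff)
    moreover have "(\<Sum>i = 1..n. p ^ (n - i) * nu (\<epsilon> i) (j i)) = (\<Sum>i<n. p ^ i * zigzag p (\<delta> i))"
      unfolding l[OF 1] by (intro sum.cong) (simp_all add: 2)
    ultimately show "\<exists>\<epsilon> j. (\<forall>i\<in>{1..n}. \<epsilon> i \<in> {1, -1} \<and> j i \<le> (p - 1) div 2) \<and>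
        (\<Sum>i<n. int (p ^ i) * int (\<delta> i)) =
        (\<Sum>i<n. int (p ^ i) * (int H + \<epsilon> (n - i) * int (j (n - i)))) \<and>
        (p - 1) * (\<Sum>i<n. p ^ i * zigzag p (\<delta> i)) =
        (p - 1) * (\<Sum>i = 1..n. p ^ (n - i) * nu (\<epsilon> i) (j i))"
      by - (rule exI[of _ \<epsilon>], rule exI[of _ j], simp)
  next
    fix x assume "\<exists>\<epsilon> j. (\<forall>i\<in>{1..n}. \<epsilon> i \<in> {1, -1} \<and> j i \<le> (p - 1) div 2) \<and>
        (\<Sum>i<n. int (p ^ i) * int (\<delta> i)) =
        (\<Sum>i<n. int (p ^ i) * (int H + \<epsilon> (n - i) * int (j (n - i)))) \<and>
        x = (p - 1) * (\<Sum>i = 1..n. p ^ (n - i) * nu (\<epsilon> i) (j i))"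
    then obtain \<epsilon> j where ej: "\<forall>i\<in>{1..n}. \<epsilon> i \<in> {1, -1} \<and> j i \<le> (p - 1) div 2"
      and eq: "(\<Sum>i<n. int (p ^ i) * int (\<delta> i)) =
        (\<Sum>i<n. int (p ^ i) * (int H + \<epsilon> (n - i) * int (j (n - i))))"
      and x: "x = (p - 1) * (\<Sum>i = 1..n. p ^ (n - i) * nu (\<epsilon> i) (j i))"
      by blast
    \<comment> \<open>The ordinary digits of an arbitrary balanced expansion; uniqueness in base
      \<open>p\<close> identifies them with \<delta>.\<close>
    define \<delta>' where "\<delta>' i = nat (int H + \<epsilon> (n - i) * int (j (n - i)))" for i
    have ni: "\<epsilon> (n - i) \<in> {1, -1}" "j (n - i) \<le> H" if "i < n" for i
      using ej that H by auto
    have \<delta>': "\<delta>' i < p" "int (\<delta>' i) = int H + \<epsilon> (n - i) * int (j (n - i))" if "i < n" for i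
      using nu_eq_zigzag(2)[OF H ni[OF that]] ni[OF that] by (auto simp: \<delta>'_def)
    have "(\<Sum>i<n. int (p ^ i) * int (\<delta>' i)) =
        (\<Sum>i<n. int (p ^ i) * (int H + \<epsilon> (n - i) * int (j (n - i))))"
      by (intro sum.cong) (simp_all only: \<delta>'(2) lessThan_iff)
    then have "int (\<Sum>i<n. p ^ i * \<delta> i) = int (\<Sum>i<n. p ^ i * \<delta>' i)"
      unfolding of_nat_sum of_nat_mult using eq by simp
    then have "(\<Sum>i<n. p ^ i * \<delta> i) = (\<Sum>i<n. p ^ i * \<delta>' i)" by (simp only: of_nat_eq_iff)
    then have "\<delta> i = \<delta>' i" if "i < n" for i
      using digit_sum_inj[of n \<delta> p \<delta>' i] \<delta> \<delta>'(1) that unfolding n_def[symmetric] by blast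
    then show "x = (p - 1) * (\<Sum>i<n. p ^ i * zigzag p (\<delta> i))"
      unfolding x l[OF ej] by (simp add: \<delta>'_def)
  qed
qed

section \<open>Range and injectivity of \<open>l\<close> on the shapes of one level\<close>

lemma W_shapes_digits:
  assumes "p \<ge> 3" "0 < s" "s \<le> r - 1" "q = p ^ (r - s - 1)" "h \<in> W_shapes p r s"
  obtains \<delta> where "\<And>i. i < r - s \<Longrightarrow> \<delta> i < p"
    and "leg h = q * leg_base p s + (\<Sum>i<r - s. p ^ i * \<delta> i)"
    and "h = hook (hook_size p q (2 * s)) (leg h)"
proof -
  obtain x where h: "h = hook (hook_size p q (2 * s)) x"
    and x: "q * leg_base p s \<le> x" "x < q * (leg_base p s + leg_width p s)"
    using assms(5) unfolding W_shapes_eq[OF assms(1,3,4)] by blast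
  have "r - s = Suc (r - s - 1)" using assms by simp
  then have "q * leg_width p s = p ^ (r - s)"
    using assms(2,4) by (simp only: power_Suc leg_width_def) simp
  then have "x - q * leg_base p s < p ^ (r - s)" using x by (simp add: distrib_left)
  from digit_sum_surj[OF this] obtain \<delta> where "\<forall>i<r - s. \<delta> i < p"
    "x - q * leg_base p s = (\<Sum>i<r - s. p ^ i * \<delta> i)" by blast
  with x h that[of \<delta>] show thesis by simp
qed

lemma l_of_range:
  assumes "odd p" "p \<ge> 3" "0 < s" "s \<le> r - 1" "h \<in> W_shapes p r s"
  obtains l where "l < p ^ (r - s)" "l_of p r s h = (p - 1) * l"
proof -
  define q where "q = p ^ (r - s - 1)"
  obtain \<delta> where \<delta>: "\<And>i. i < r - s \<Longrightarrow> \<delta> i < p"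
    "leg h = q * leg_base p s + (\<Sum>i<r - s. p ^ i * \<delta> i)"
    using W_shapes_digits[OF assms(2-4) q_def assms(5)] by blast
  show thesis
  proof (rule that)
    show "(\<Sum>i<r - s. p ^ i * zigzag p (\<delta> i)) < p ^ (r - s)"
      using \<delta>(1) by (intro digit_sum_less zigzag_less assms)
  qed (rule l_of_eq[OF assms(1-4) q_def \<delta>(2,1)])
qed

lemma l_of_inj_on:
  assumes "odd p" "p \<ge> 3" "0 < s" "s \<le> r - 1"
  shows "inj_on (l_of p r s) (W_shapes p r s)"
proof (rule inj_onI)
  fix h h' assume hh: "h \<in> W_shapes p r s" "h' \<in> W_shapes p r s" "l_of p r s h = l_of p r s h'"
  define q where "q = p ^ (r - s - 1)"
  obtain \<delta> where \<delta>: "\<And>i. i < r - s \<Longrightarrow> \<delta> i < p"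
    "leg h = q * leg_base p s + (\<Sum>i<r - s. p ^ i * \<delta> i)"
    "h = hook (hook_size p q (2 * s)) (leg h)"
    using W_shapes_digits[OF assms(2-4) q_def hh(1)] by blast
  obtain \<delta>' where \<delta>': "\<And>i. i < r - s \<Longrightarrow> \<delta>' i < p"
    "leg h' = q * leg_base p s + (\<Sum>i<r - s. p ^ i * \<delta>' i)"
    "h' = hook (hook_size p q (2 * s)) (leg h')"
    using W_shapes_digits[OF assms(2-4) q_def hh(2)] by blast
  have "(\<Sum>i<r - s. p ^ i * zigzag p (\<delta> i)) = (\<Sum>i<r - s. p ^ i * zigzag p (\<delta>' i))"
    using l_of_eq[OF assms q_def \<delta>(2,1)] l_of_eq[OF assms q_def \<delta>'(2,1)] hh(3) assms(2) by simp
  then have "zigzag p (\<delta> i) = zigzag p (\<delta>' i)" if "i < r - s" for i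
    using digit_sum_inj[of "r - s" "\<lambda>i. zigzag p (\<delta> i)" p "\<lambda>i. zigzag p (\<delta>' i)" i]
      that \<delta>(1) \<delta>'(1) zigzag_less[OF assms(1)] by simp
  then have "\<delta> i = \<delta>' i" if "i < r - s" for i
    using that zigzag_inj by blast
  then have "leg h = leg h'" using \<delta>(2) \<delta>'(2) by simp
  then show "h = h'" using \<delta>(3) \<delta>'(3) by metis
qed

lemma card_W_shapes:
  assumes "p \<ge> 3" "0 < s" "s \<le> r - 1"
  shows "card (W_shapes p r s) = p ^ (r - s)"
proof -
  define q where "q = p ^ (r - s - 1)"
  have "W_shapes p r s = hook (hook_size p q (2 * s)) `
      {q * leg_base p s..<q * (leg_base p s + leg_width p s)}"
    unfolding W_shapes_eq[OF assms(1,3) q_def] by auto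
  also have "card \<dots> = q * leg_width p s"
    by (subst card_image) (auto simp: inj_on_def distrib_left dest: hook_inject)
  also have "\<dots> = p ^ Suc (r - s - 1)" using assms by (simp add: q_def leg_width_def)
  also have "Suc (r - s - 1) = r - s" using assms by simp
  finally show ?thesis .
qed

section \<open>Exponents in the group\<close>

text \<open>The rewriting rule behind the normal form: moving one \<tau> to the left past a power of
  \<open>g\<close> multiplies the exponent of \<open>g\<close> by \<open>t\<close>.\<close>

lemma (in group) conj_pow_commute:
  assumes "g \<in> carrier G" "\<tau> \<in> carrier G" "inv \<tau> \<otimes> g \<otimes> \<tau> = g [^] (t :: nat)"
  shows "g [^] (n :: nat) \<otimes> \<tau> [^] (m :: nat) = \<tau> [^] m \<otimes> g [^] (n * t ^ m)"
proof -
  have g\<tau>: "g \<otimes> \<tau> = \<tau> \<otimes> g [^] t"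
    using assms by (metis inv_closed inv_solve_left m_assoc m_closed)
  have step: "g [^] n \<otimes> \<tau> = \<tau> \<otimes> g [^] (n * t)" for n :: nat
  proof (induction n)
    case (Suc n)
    have "g [^] Suc n \<otimes> \<tau> = g [^] n \<otimes> \<tau> \<otimes> g [^] t"
      using assms(1,2) g\<tau> by (simp add: m_assoc)
    also have "\<dots> = \<tau> \<otimes> (g [^] (n * t) \<otimes> g [^] t)"
      using assms(1,2) Suc by (simp add: m_assoc)
    finally show ?case using assms(1) by (simp add: nat_pow_mult add.commute)
  qed (use assms in simp)
  show ?thesis
  proof (induction m)
    case (Suc m)
    have "g [^] n \<otimes> \<tau> [^] Suc m = g [^] n \<otimes> \<tau> [^] m \<otimes> \<tau>"
      using assms(1,2) by (simp add: m_assoc)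
    also have "\<dots> = \<tau> [^] m \<otimes> (g [^] (n * t ^ m) \<otimes> \<tau>)"
      using assms(1,2) Suc by (simp add: m_assoc)
    also have "\<dots> = \<tau> [^] Suc m \<otimes> g [^] (n * t ^ m * t)"
      using assms(1,2) step by (simp add: m_assoc)
    finally show ?case by (simp add: mult_ac)
  qed (use assms in simp)
qed

lemma (in group) pow_eq_iff_cong:
  assumes "x \<in> carrier G"
  shows "x [^] (a :: nat) = x [^] (b :: nat) \<longleftrightarrow> [a = b] (mod ord x)"
proof -
  have "x [^] a = x [^] b \<longleftrightarrow> int (ord x) dvd int b - int a"
    using int_pow_eq[OF assms, of "int a" "int b"] by (simp add: int_pow_int)
  also have "\<dots> \<longleftrightarrow> [a = b] (mod ord x)"
    by (metis cong_iff_dvd_diff cong_int_iff cong_sym_eq)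
  finally show ?thesis .
qed

text \<open>For x = \<tau>^a g^b one has g x = x g^(t^a), so x determines t^a modulo
  \<open>p ^ r\<close>. As \<open>t\<close> is a primitive root, this gives a modulo the order of
  \<tau>, and cancelling \<tau>^a gives b.\<close>

lemma is_G_exponents_unique:
  assumes "prime p" "0 < r" "is_G p r t G g \<tau>"
    and eq: "\<tau> [^]\<^bsub>G\<^esub> (a :: nat) \<otimes>\<^bsub>G\<^esub> g [^]\<^bsub>G\<^esub> (b :: nat) = \<tau> [^]\<^bsub>G\<^esub> (a' :: nat) \<otimes>\<^bsub>G\<^esub> g [^]\<^bsub>G\<^esub> (b' :: nat)"
  shows "[a = a'] (mod p ^ (r - 1) * (p - 1))" "[b = b'] (mod p ^ r)"
proof -
  interpret group G using assms by (simp add: is_G_def)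
  have G: "g \<in> carrier G" "\<tau> \<in> carrier G" "group.ord G g = p ^ r"
    "group.ord G \<tau> = p ^ (r - 1) * (p - 1)" "residue_primroot (p ^ r) t"
    "inv\<^bsub>G\<^esub> \<tau> \<otimes>\<^bsub>G\<^esub> g \<otimes>\<^bsub>G\<^esub> \<tau> = g [^]\<^bsub>G\<^esub> t"
    using assms by (auto simp: is_G_def)
  have conj: "g \<otimes>\<^bsub>G\<^esub> (\<tau> [^]\<^bsub>G\<^esub> a \<otimes>\<^bsub>G\<^esub> g [^]\<^bsub>G\<^esub> b) = \<tau> [^]\<^bsub>G\<^esub> a \<otimes>\<^bsub>G\<^esub> g [^]\<^bsub>G\<^esub> b \<otimes>\<^bsub>G\<^esub> g [^]\<^bsub>G\<^esub> (t ^ a)"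
    for a b :: nat
  proof -
    have "g \<otimes>\<^bsub>G\<^esub> (\<tau> [^]\<^bsub>G\<^esub> a \<otimes>\<^bsub>G\<^esub> g [^]\<^bsub>G\<^esub> b) = g [^]\<^bsub>G\<^esub> (1 :: nat) \<otimes>\<^bsub>G\<^esub> \<tau> [^]\<^bsub>G\<^esub> a \<otimes>\<^bsub>G\<^esub> g [^]\<^bsub>G\<^esub> b"
      using G by (simp add: m_assoc)
    also have "\<dots> = \<tau> [^]\<^bsub>G\<^esub> a \<otimes>\<^bsub>G\<^esub> g [^]\<^bsub>G\<^esub> (t ^ a) \<otimes>\<^bsub>G\<^esub> g [^]\<^bsub>G\<^esub> b"
      unfolding conj_pow_commute[OF G(1,2,6)] by simp
    finally show ?thesis using G by (simp add: m_assoc nat_pow_mult add.commute)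
  qed
  have "g [^]\<^bsub>G\<^esub> (t ^ a) = g [^]\<^bsub>G\<^esub> (t ^ a')"
  proof -
    have "\<tau> [^]\<^bsub>G\<^esub> a \<otimes>\<^bsub>G\<^esub> g [^]\<^bsub>G\<^esub> b \<otimes>\<^bsub>G\<^esub> g [^]\<^bsub>G\<^esub> (t ^ a) = \<tau> [^]\<^bsub>G\<^esub> a \<otimes>\<^bsub>G\<^esub> g [^]\<^bsub>G\<^esub> b \<otimes>\<^bsub>G\<^esub> g [^]\<^bsub>G\<^esub> (t ^ a')"
      using conj[of a b] conj[of a' b'] eq by simp
    then show ?thesis using G by simp
  qed
  then have "[t ^ a = t ^ a'] (mod p ^ r)"
    using pow_eq_iff_cong[OF G(1)] G(3) by simp
  then show a: "[a = a'] (mod p ^ (r - 1) * (p - 1))"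
    using G(5) assms(1,2) order_divides_expdiff[of "p ^ r" t a a']
    unfolding residue_primroot_def by (simp add: totient_prime_power)
  then have "\<tau> [^]\<^bsub>G\<^esub> a = \<tau> [^]\<^bsub>G\<^esub> a'" using pow_eq_iff_cong[OF G(2)] G(4) by simp
  with eq G have "g [^]\<^bsub>G\<^esub> b = g [^]\<^bsub>G\<^esub> b'" by simp
  then show "[b = b'] (mod p ^ r)" using pow_eq_iff_cong[OF G(1)] G(3) by simp
qed

section \<open>Membership in \<open>SG\<close> and a bound on its size\<close>

lemma pow_mult_pow_in_SG:
  assumes "prime p" "0 < r" "is_G p r t G g \<tau>"
  shows "\<tau> [^]\<^bsub>G\<^esub> (a :: nat) \<otimes>\<^bsub>G\<^esub> g [^]\<^bsub>G\<^esub> (p * b) \<in> SG p r G g \<tau>"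
proof -
  interpret group G using assms by (simp add: is_G_def)
  have G: "g \<in> carrier G" "\<tau> \<in> carrier G" "group.ord G g = p ^ r"
    "group.ord G \<tau> = p ^ (r - 1) * (p - 1)"
    using assms by (auto simp: is_G_def)
  \<comment> \<open>The exponents in \<open>SG\<close> start at 1, so the class of 0 is represented
    by \<open>n\<close>.\<close>
  have rep: "\<exists>i. 1 \<le> i \<and> i \<le> n \<and> [i = a] (mod n)" if "0 < n" for n a :: nat
    using that by (intro exI[of _ "if a mod n = 0 then n else a mod n"])
      (auto simp: cong_def less_imp_le)
  obtain i where i: "1 \<le> i" "i \<le> p ^ (r - 1) * (p - 1)" "[i = a] (mod p ^ (r - 1) * (p - 1))"
    using rep[of "p ^ (r - 1) * (p - 1)" a] prime_gt_1_nat[OF assms(1)] by auto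
  obtain j where j: "1 \<le> j" "j \<le> p ^ (r - 1)" "[j = b] (mod p ^ (r - 1))"
    using rep[of "p ^ (r - 1)" b] prime_gt_1_nat[OF assms(1)] by auto
  have "[p * j = p * b] (mod p ^ r)"
    using j(3) assms(2) by (cases r) (auto simp: cong_def mod_mult_mult1)
  then have "g [^]\<^bsub>G\<^esub> (p * j) = g [^]\<^bsub>G\<^esub> (p * b)" using pow_eq_iff_cong[OF G(1)] G(3) by simp
  moreover have "\<tau> [^]\<^bsub>G\<^esub> i = \<tau> [^]\<^bsub>G\<^esub> a" using i(3) pow_eq_iff_cong[OF G(2)] G(4) by simp
  moreover have "\<tau> [^]\<^bsub>G\<^esub> i \<otimes>\<^bsub>G\<^esub> g [^]\<^bsub>G\<^esub> (p * j) \<in> SG p r G g \<tau>"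
    unfolding SG_def using i j by blast
  ultimately show ?thesis by simp
qed

lemma finite_SG: "finite (SG p r G g \<tau>)"
  and card_SG_le: "card (SG p r G g \<tau>) \<le> p ^ (r - 1) * (p - 1) * p ^ (r - 1)"
proof -
  let ?I = "{1..p ^ (r - 1) * (p - 1)} \<times> {1..p ^ (r - 1)}"
  let ?f = "\<lambda>(i :: nat, j :: nat). \<tau> [^]\<^bsub>G\<^esub> i \<otimes>\<^bsub>G\<^esub> g [^]\<^bsub>G\<^esub> (p * j)"
  have eq: "SG p r G g \<tau> = ?f ` ?I"
    by (auto simp only: SG_def image_iff Bex_def mem_Times_iff split_beta fst_conv snd_conv
        atLeastAtMost_iff split_paired_Ex mem_Collect_eq) blast+
  then show "finite (SG p r G g \<tau>)" by simp
  show "card (SG p r G g \<tau>) \<le> p ^ (r - 1) * (p - 1) * p ^ (r - 1)"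
    using card_image_le[of ?I ?f] unfolding eq by simp
qed

text \<open>Since \<open>t\<close> is prime to \<open>p\<close>, the gcd of either side with
  \<open>p ^ r\<close> is its power of \<open>p\<close>. Dividing it out leaves a congruence modulo
  \<open>p ^ s\<close>.\<close>

lemma prime_power_mult_cong:
  fixes t :: nat
  assumes "prime p" "coprime p t" "s \<le> r" "s' \<le> r"
    and "[p ^ (r - s) * t ^ e = p ^ (r - s') * t ^ e'] (mod p ^ r)"
  shows "s = s' \<and> [t ^ e = t ^ e'] (mod p ^ s)"
proof -
  have pr: "p ^ r = p ^ (r - s) * p ^ s" if "s \<le> r" for s
    using that by (simp flip: power_add)
  have gcd: "gcd (p ^ (r - s) * t ^ e) (p ^ r) = p ^ (r - s)" if "s \<le> r" for s e
  proof -
    have "coprime (t ^ e) (p ^ s)" using assms(2) by (simp add: coprime_commute)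
    then show ?thesis unfolding pr[OF that] gcd_mult_left by simp
  qed
  have "p ^ (r - s) = p ^ (r - s')"
    using cong_gcd_eq[OF assms(5)] gcd assms(3,4) by simp
  then have s: "s = s'"
    using prime_gt_1_nat[OF assms(1)] assms(3,4) by simp
  have "p ^ (r - s) * (t ^ e mod p ^ s) = p ^ (r - s) * (t ^ e' mod p ^ s)"
    using assms(5) unfolding s[symmetric] cong_def pr[OF assms(3)] mod_mult_mult1 .
  then show ?thesis
    using s prime_gt_0_nat[OF assms(1)] by (simp add: cong_def)
qed

text \<open>Reducing the exponents modulo \<open>p ^ (s - 1) * (p - 1)\<close>, the order of \<open>t\<close> modulo \<open>p ^ s\<close>,
  isolates first \<open>j\<close> and then \<open>i\<close>; what remains modulo the order of \<open>\<tau>\<close> is \<open>l\<close>.\<close>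

lemma exponents_inject:
  fixes p r s t c :: nat
  defines "M \<equiv> p ^ (s - 1) * (p - 1)" and "N \<equiv> p ^ (r - 1) * (p - 1)"
  assumes "prime p" "residue_primroot (p ^ r) t" "0 < s" "s \<le> r"
    and ij: "i \<in> {1..M}" "j \<in> {1..M}" "i' \<in> {1..M}" "j' \<in> {1..M}"
    and l: "l < p ^ (r - s)" "l' < p ^ (r - s)"
    and z: "[int z = - (int i - 1)] (mod int N)" "[int z' = - (int i' - 1)] (mod int N)"
  defines "e \<equiv> c + (j - 1) + (p - 1) * l * M" and "e' \<equiv> c + (j' - 1) + (p - 1) * l' * M"
  assumes eqt: "[t ^ e = t ^ e'] (mod p ^ s)" and eqz: "[z + e = z' + e'] (mod N)"
  shows "i = i' \<and> j = j' \<and> l = l'"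
proof -
  have p: "p > 1" using \<open>prime p\<close> by (rule prime_gt_1_nat)
  have "r - 1 = (s - 1) + (r - s)" using assms by simp
  then have N: "N = M * p ^ (r - s)"
    unfolding N_def M_def by (simp only: power_add mult_ac)
  have "residue_primroot (p ^ s) t"
    using assms residue_primroot_prime_power_le by blast
  then have ee: "[e = e'] (mod M)"
    using eqt order_divides_expdiff[of "p ^ s" t e e'] \<open>0 < s\<close> \<open>prime p\<close>
    by (simp add: residue_primroot_def totient_prime_power M_def)
  \<comment> \<open>The constant \<open>c\<close> is common to both sides, and the terms with
    \<open>l\<close> and \<open>l'\<close> are multiples of \<open>M\<close>.\<close>
  then have "[j - 1 = j' - 1] (mod M)"
    unfolding e_def e'_def by (simp add: cong_def) (simp add: cong_add_lcancel_nat flip: cong_def)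
  then have j: "j = j'"
    using ij by (auto dest!: cong_less_modulus_unique_nat)
  \<comment> \<open>Since \<open>M\<close> divides \<open>N\<close>, this congruence may be reduced
    modulo \<open>M\<close>, where \<open>e\<close> and \<open>e'\<close> already agree; only
    \<open>z\<close>, which carries \<open>i\<close>, remains.\<close>
  have "[z + e = z' + e'] (mod M)"
    using eqz N cong_modulus_mult_nat by blast
  then have "[z + e = z' + e] (mod M)"
    using cong_add[OF cong_refl[of z' M] ee] cong_sym cong_trans by blast
  then have "[int z = int z'] (mod int M)" by (simp add: cong_add_rcancel_nat cong_int_iff)
  moreover have "int M dvd int N" using N by simp
  then have "[int z = - (int i - 1)] (mod int M)" "[int z' = - (int i' - 1)] (mod int M)"
    using z cong_dvd_modulus by blast+
  ultimately have "[- (int i - 1) = - (int i' - 1)] (mod int M)"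
    using cong_sym cong_trans by blast
  then have "[int i - 1 = int i' - 1] (mod int M)"
    by (simp only: cong_minus_minus_iff)
  then have "[int (i - 1) = int (i' - 1)] (mod int M)"
    using ij by (simp add: of_nat_diff)
  then have i: "i = i'"
    using ij by (auto simp: cong_int_iff dest!: cong_less_modulus_unique_nat)
  have "[int z = int z'] (mod int N)" using z i cong_sym cong_trans by blast
  then have "[z = z'] (mod N)" by (simp add: cong_int_iff)
  then have "[z + e = z + e'] (mod N)"
    using eqz cong_add[OF _ cong_refl[of e' N]] cong_sym cong_trans by blast
  then have "[(p - 1) * l * M = (p - 1) * l' * M] (mod N)"
    unfolding e_def e'_def j by (simp add: cong_add_lcancel_nat)
  then have "M * ((p - 1) * l mod p ^ (r - s)) = M * ((p - 1) * l' mod p ^ (r - s))"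
    by (simp only: cong_def N mult.commute[of _ M] mod_mult_mult1)
  then have "[(p - 1) * l = (p - 1) * l'] (mod p ^ (r - s))"
    using p by (simp add: cong_def M_def)
  \<comment> \<open>The factor \<open>p - 1\<close> in \<open>l_of\<close> is invertible modulo
    powers of \<open>p\<close>, so it does not merge values of \<open>l\<close>.\<close>
  moreover have "coprime (p - 1) (p ^ (r - s))"
    using p coprime_diff_one_left_nat[of p] by simp
  ultimately have "[l = l'] (mod p ^ (r - s))"
    by (simp add: cong_mult_lcancel_nat)
  with l i j show ?thesis by (auto dest!: cong_less_modulus_unique_nat)
qed

text \<open>The integer exponent of \<tau> on the left is replaced by its natural representative
  \<open>z\<close> modulo \<open>N\<close>. All \<tau>-powers to the right of \<open>g\<close> then
  merge into \<open>e\<close> and move to the left together.\<close>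

lemma h_map_eq:
  fixes p r s :: nat
  assumes "prime p" "0 < s" "s \<le> r - 1" "is_G p r t G g \<tau>"
    and "P \<in> SYT_W p r s h" "Q \<in> SYT_W p r s h" "number_W p r s P \<ge> 1"
  defines "N \<equiv> p ^ (r - 1) * (p - 1)"
  defines "z \<equiv> nat (- (int (number_W p r s P) - 1) mod int N)"
    and "e \<equiv> N div 2 + (number_W p r s Q - 1) + l_of p r s h * (p ^ (s - 1) * (p - 1))"
  shows "h_map p r G g \<tau> jmap (P, Q) = \<tau> [^]\<^bsub>G\<^esub> (z + e) \<otimes>\<^bsub>G\<^esub> g [^]\<^bsub>G\<^esub> (p ^ (r - s) * t ^ e)"
proof -
  interpret group G using assms by (simp add: is_G_def)
  have G: "g \<in> carrier G" "\<tau> \<in> carrier G" "group.ord G \<tau> = N"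
    "inv\<^bsub>G\<^esub> \<tau> \<otimes>\<^bsub>G\<^esub> g \<otimes>\<^bsub>G\<^esub> \<tau> = g [^]\<^bsub>G\<^esub> t"
    using assms by (auto simp: is_G_def)
  have "N > 0" using prime_gt_1_nat[OF assms(1)] by (simp add: N_def)
  have len: "(length P - 1) div 2 = s" "last P = h"
    using length_SYT_W[OF assms(5)] by simp_all
  have "int z = - (int (number_W p r s P) - 1) mod int N"
    using \<open>N > 0\<close> by (simp add: z_def)
  then have z: "\<tau> [^]\<^bsub>G\<^esub> (- (int (number_W p r s P) - 1)) = \<tau> [^]\<^bsub>G\<^esub> z"
    unfolding int_pow_int[symmetric] int_pow_eq[OF G(2)] G(3) by (simp add: mod_eq_dvd_iff[symmetric])
  have "p * p ^ (r - s - 1) = p ^ (r - s)"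
    using assms(2,3) by (simp add: Suc_diff_Suc flip: power_Suc)
  then have g: "(g [^]\<^bsub>G\<^esub> p) [^]\<^bsub>G\<^esub> (p ^ (r - s - 1)) = g [^]\<^bsub>G\<^esub> (p ^ (r - s))"
    using G by (simp add: nat_pow_pow)
  have "h_map p r G g \<tau> jmap (P, Q) = \<tau> [^]\<^bsub>G\<^esub> z \<otimes>\<^bsub>G\<^esub> g [^]\<^bsub>G\<^esub> (p ^ (r - s)) \<otimes>\<^bsub>G\<^esub> \<tau> [^]\<^bsub>G\<^esub> (N div 2)
      \<otimes>\<^bsub>G\<^esub> \<tau> [^]\<^bsub>G\<^esub> (number_W p r s Q - 1) \<otimes>\<^bsub>G\<^esub> \<tau> [^]\<^bsub>G\<^esub> (l_of p r s h * (p ^ (s - 1) * (p - 1)))"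
    unfolding h_map_def Let_def case_prod_conv len z g N_def[symmetric]
    using assms(2) by (simp add: mult.assoc)
  also have "\<dots> = \<tau> [^]\<^bsub>G\<^esub> z \<otimes>\<^bsub>G\<^esub> (g [^]\<^bsub>G\<^esub> (p ^ (r - s)) \<otimes>\<^bsub>G\<^esub> \<tau> [^]\<^bsub>G\<^esub> e)"
    using G by (simp add: e_def m_assoc flip: nat_pow_mult)
  also have "\<dots> = \<tau> [^]\<^bsub>G\<^esub> (z + e) \<otimes>\<^bsub>G\<^esub> g [^]\<^bsub>G\<^esub> (p ^ (r - s) * t ^ e)"
    unfolding conj_pow_commute[OF G(1,2,4)] using G by (simp add: m_assoc flip: nat_pow_mult)
  finally show ?thesis .
qed

section \<open>The map on pairs of tableaux\<close>

lemma h_map_single: "h_map p r G g \<tau> jmap ([h], [h]) = \<tau> [^]\<^bsub>G\<^esub> jmap (leg h)"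
  by (simp add: h_map_def)

lemma tableau_pairsE:
  assumes "x \<in> tableau_pairs p r"
  obtains s h P Q where "x = (P, Q)" "s \<le> r - 1" "h \<in> W_shapes p r s"
    "P \<in> SYT_W p r s h" "Q \<in> SYT_W p r s h"
  using assms by (auto simp: tableau_pairs_def)

text \<open>The case \<open>s = 0\<close> takes the same form, with \<open>g [^] p ^ r = \<one>\<close>.\<close>

lemma h_map_normal_form:
  assumes "prime p" "odd p" "0 < r" "is_G p r t G g \<tau>"
    and "s \<le> r - 1" "h \<in> W_shapes p r s" "P \<in> SYT_W p r s h" "Q \<in> SYT_W p r s h"
  obtains a e where
    "h_map p r G g \<tau> jmap (P, Q) = \<tau> [^]\<^bsub>G\<^esub> (a :: nat) \<otimes>\<^bsub>G\<^esub> g [^]\<^bsub>G\<^esub> (p ^ (r - s) * t ^ e)"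
    and "s = 0 \<longrightarrow> a = jmap (leg h)"
    and "0 < s \<longrightarrow> (\<exists>z l. a = z + e \<and> l_of p r s h = (p - 1) * l \<and> l < p ^ (r - s) \<and>
      [int z = - (int (number_W p r s P) - 1)] (mod int (p ^ (r - 1) * (p - 1))) \<and>
      e = p ^ (r - 1) * (p - 1) div 2 + (number_W p r s Q - 1) + (p - 1) * l * (p ^ (s - 1) * (p - 1)))"
proof (cases "s = 0")
  case True
  interpret group G using assms by (simp add: is_G_def)
  have G: "g \<in> carrier G" "\<tau> \<in> carrier G" "group.ord G g = p ^ r"
    using assms by (auto simp: is_G_def)
  have "g [^]\<^bsub>G\<^esub> (p ^ r) = \<one>\<^bsub>G\<^esub>" using G pow_ord_eq_1 by metis
  then have "h_map p r G g \<tau> jmap (P, Q) = \<tau> [^]\<^bsub>G\<^esub> jmap (leg h) \<otimes>\<^bsub>G\<^esub> g [^]\<^bsub>G\<^esub> (p ^ (r - s) * t ^ 0)"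
    using assms G True by (simp add: SYT_W_def h_map_single)
  then show thesis using True that[of "jmap (leg h)" 0] by simp
next
  case False
  then have s: "0 < s" by simp
  have p: "p \<ge> 3"
    using prime_ge_2_nat[OF assms(1)] assms(2) by (cases "p = 2") auto
  obtain l where l: "l < p ^ (r - s)" "l_of p r s h = (p - 1) * l"
    using l_of_range[OF assms(2) p s assms(5,6)] by blast
  define N where "N = p ^ (r - 1) * (p - 1)"
  define z where "z = nat (- (int (number_W p r s P) - 1) mod int N)"
  define e where "e = N div 2 + (number_W p r s Q - 1) + l_of p r s h * (p ^ (s - 1) * (p - 1))"
  have "N > 0" using p by (simp add: N_def)
  then have z: "[int z = - (int (number_W p r s P) - 1)] (mod int N)"
    by (simp add: z_def cong_def)
  have "number_W p r s P \<ge> 1"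
    using number_W_range[OF assms(2) p s assms(5,7,6)] by simp
  from h_map_eq[OF assms(1) s assms(5,4,7,8) this]
  have "h_map p r G g \<tau> jmap (P, Q) = \<tau> [^]\<^bsub>G\<^esub> (z + e) \<otimes>\<^bsub>G\<^esub> g [^]\<^bsub>G\<^esub> (p ^ (r - s) * t ^ e)"
    unfolding N_def[symmetric] z_def[symmetric] e_def[symmetric] .
  then show thesis
    using that[of "z + e" e] s z l unfolding e_def N_def by auto
qed

text \<open>The exponents first show that both pairs lie on one level \<open>s\<close>. At level 0
  the injectivity of \<open>jmap\<close> finishes; above it, \<open>exponents_inject\<close> yields
  the two numbers and \<open>l\<close>.\<close>

lemma h_map_inj_on:
  assumes "prime p" "odd p" "0 < r" "is_G p r t G g \<tau>"
    and "inj_on jmap {0..<p ^ (r - 1) * (p - 1)}"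
    and "jmap ` {0..<p ^ (r - 1) * (p - 1)} \<subseteq> {0..<p ^ (r - 1) * (p - 1)}"
  shows "inj_on (h_map p r G g \<tau> jmap) (tableau_pairs p r)"
proof (rule inj_onI)
  fix x x' assume x: "x \<in> tableau_pairs p r" "x' \<in> tableau_pairs p r"
    and eq: "h_map p r G g \<tau> jmap x = h_map p r G g \<tau> jmap x'"
  define N where "N = p ^ (r - 1) * (p - 1)"
  have p: "p \<ge> 3"
    using prime_ge_2_nat[OF assms(1)] assms(2) by (cases "p = 2") auto
  have root: "residue_primroot (p ^ r) t" using assms by (simp add: is_G_def)
  then have "coprime p t" using assms(3) by (simp add: residue_primroot_def)
  obtain s h P Q where PQ: "x = (P, Q)" "s \<le> r - 1" "h \<in> W_shapes p r s"
    "P \<in> SYT_W p r s h" "Q \<in> SYT_W p r s h"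
    using x(1) by (rule tableau_pairsE)
  obtain s' h' P' Q' where PQ': "x' = (P', Q')" "s' \<le> r - 1" "h' \<in> W_shapes p r s'"
    "P' \<in> SYT_W p r s' h'" "Q' \<in> SYT_W p r s' h'"
    using x(2) by (rule tableau_pairsE)
  obtain a e where ae:
    "h_map p r G g \<tau> jmap (P, Q) = \<tau> [^]\<^bsub>G\<^esub> (a :: nat) \<otimes>\<^bsub>G\<^esub> g [^]\<^bsub>G\<^esub> (p ^ (r - s) * t ^ e)"
    "s = 0 \<longrightarrow> a = jmap (leg h)"
    "0 < s \<longrightarrow> (\<exists>z l. a = z + e \<and> l_of p r s h = (p - 1) * l \<and> l < p ^ (r - s) \<and>
      [int z = - (int (number_W p r s P) - 1)] (mod int (p ^ (r - 1) * (p - 1))) \<and>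
      e = p ^ (r - 1) * (p - 1) div 2 + (number_W p r s Q - 1) + (p - 1) * l * (p ^ (s - 1) * (p - 1)))"
    using h_map_normal_form[OF assms(1-4) PQ(2-5)] .
  obtain a' e' where ae':
    "h_map p r G g \<tau> jmap (P', Q') = \<tau> [^]\<^bsub>G\<^esub> (a' :: nat) \<otimes>\<^bsub>G\<^esub> g [^]\<^bsub>G\<^esub> (p ^ (r - s') * t ^ e')"
    "s' = 0 \<longrightarrow> a' = jmap (leg h')"
    "0 < s' \<longrightarrow> (\<exists>z l. a' = z + e' \<and> l_of p r s' h' = (p - 1) * l \<and> l < p ^ (r - s') \<and>
      [int z = - (int (number_W p r s' P') - 1)] (mod int (p ^ (r - 1) * (p - 1))) \<and>
      e' = p ^ (r - 1) * (p - 1) div 2 + (number_W p r s' Q' - 1) + (p - 1) * l * (p ^ (s' - 1) * (p - 1)))"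
    using h_map_normal_form[OF assms(1-4) PQ'(2-5)] .
  have "\<tau> [^]\<^bsub>G\<^esub> a \<otimes>\<^bsub>G\<^esub> g [^]\<^bsub>G\<^esub> (p ^ (r - s) * t ^ e) =
      \<tau> [^]\<^bsub>G\<^esub> a' \<otimes>\<^bsub>G\<^esub> g [^]\<^bsub>G\<^esub> (p ^ (r - s') * t ^ e')"
    using eq ae(1) ae'(1) PQ(1) PQ'(1) by simp
  from is_G_exponents_unique[OF assms(1,3,4) this]
  have a: "[a = a'] (mod N)" and b: "[p ^ (r - s) * t ^ e = p ^ (r - s') * t ^ e'] (mod p ^ r)"
    unfolding N_def by blast+
  have "s \<le> r" "s' \<le> r" using PQ(2) PQ'(2) by simp_all
  then have s: "s' = s" and te: "[t ^ e = t ^ e'] (mod p ^ s)"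
    using prime_power_mult_cong[OF assms(1) \<open>coprime p t\<close> _ _ b] by auto
  note PQ' = PQ'[unfolded s] and ae' = ae'[unfolded s]
  show "x = x'"
  proof (cases "s = 0")
    case True
    obtain i i' where i: "h = hook N i" "i < N" "h' = hook N i'" "i' < N"
      using PQ(3) PQ'(3) True by (auto simp: W_shapes_def N_def)
    then have "jmap i < N" "jmap i' < N"
      using assms(6)[folded N_def] by (auto simp: image_subset_iff)
    then have "jmap i = jmap i'"
      using a ae(2) ae'(2) True i by (auto dest!: cong_less_modulus_unique_nat)
    then have "i = i'"
      using assms(5)[folded N_def] i by (auto dest: inj_onD)
    then show ?thesis using i PQ PQ' True by (simp add: SYT_W_def)
  next
    case False
    then have s0: "0 < s" "s \<le> r" using PQ(2) by auto
    obtain z l where zl: "a = z + e" "l_of p r s h = (p - 1) * l" "l < p ^ (r - s)"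
      "[int z = - (int (number_W p r s P) - 1)] (mod int (p ^ (r - 1) * (p - 1)))"
      "e = p ^ (r - 1) * (p - 1) div 2 + (number_W p r s Q - 1) + (p - 1) * l * (p ^ (s - 1) * (p - 1))"
      using ae(3) s0 by blast
    obtain z' l' where zl': "a' = z' + e'" "l_of p r s h' = (p - 1) * l'" "l' < p ^ (r - s)"
      "[int z' = - (int (number_W p r s P') - 1)] (mod int (p ^ (r - 1) * (p - 1)))"
      "e' = p ^ (r - 1) * (p - 1) div 2 + (number_W p r s Q' - 1) + (p - 1) * l' * (p ^ (s - 1) * (p - 1))"
      using ae'(3) s0 by blast
    note range = number_W_range[OF assms(2) p s0(1) PQ(2)]
    have nums: "number_W p r s P = number_W p r s P' \<and> number_W p r s Q = number_W p r s Q' \<and> l = l'"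
    proof (rule exponents_inject[OF assms(1) root s0])
      show "[t ^ (p ^ (r - 1) * (p - 1) div 2 + (number_W p r s Q - 1) + (p - 1) * l * (p ^ (s - 1) * (p - 1))) =
          t ^ (p ^ (r - 1) * (p - 1) div 2 + (number_W p r s Q' - 1) + (p - 1) * l' * (p ^ (s - 1) * (p - 1)))] (mod p ^ s)"
        using te zl(5) zl'(5) by simp
      show "[z + (p ^ (r - 1) * (p - 1) div 2 + (number_W p r s Q - 1) + (p - 1) * l * (p ^ (s - 1) * (p - 1))) =
          z' + (p ^ (r - 1) * (p - 1) div 2 + (number_W p r s Q' - 1) + (p - 1) * l' * (p ^ (s - 1) * (p - 1)))]
          (mod p ^ (r - 1) * (p - 1))"
        using a zl(1,5) zl'(1,5) by (simp add: N_def)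
    qed (use range PQ PQ' zl zl' in blast)+
    \<comment> \<open>The shape has to be recovered from \<open>l\<close> first, because a number
      identifies a tableau only among those of one shape.\<close>
    then have "h = h'"
      using inj_onD[OF l_of_inj_on[OF assms(2) p s0(1) PQ(2)]] zl(2) zl'(2) PQ(3) PQ'(3) by simp
    then have "P = P'" "Q = Q'"
      using inj_onD[OF number_W_inj_on[OF assms(2) p s0(1) PQ(2,3)]] nums PQ PQ' by auto
    then show ?thesis using PQ(1) PQ'(1) by simp
  qed
qed

text \<open>Since \<open>s < r\<close>, the exponent of \<open>g\<close> in the normal form keeps at
  least one factor \<open>p\<close>.\<close>

lemma h_map_in_SG:
  assumes "prime p" "odd p" "0 < r" "is_G p r t G g \<tau>" "x \<in> tableau_pairs p r"
  shows "h_map p r G g \<tau> jmap x \<in> SG p r G g \<tau>"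
proof -
  obtain s h P Q where PQ: "x = (P, Q)" "s \<le> r - 1" "h \<in> W_shapes p r s"
    "P \<in> SYT_W p r s h" "Q \<in> SYT_W p r s h"
    using assms(5) by (rule tableau_pairsE)
  obtain a e where
    "h_map p r G g \<tau> jmap (P, Q) = \<tau> [^]\<^bsub>G\<^esub> (a :: nat) \<otimes>\<^bsub>G\<^esub> g [^]\<^bsub>G\<^esub> (p ^ (r - s) * t ^ e)"
    using h_map_normal_form[OF assms(1-4) PQ(2-5)] by blast
  moreover have "p ^ (r - s) * t ^ e = p * (p ^ (r - s - 1) * t ^ e)"
  proof -
    have "r - s = Suc (r - s - 1)" using PQ(2) assms(3) by simp
    then have "p ^ (r - s) = p * p ^ (r - s - 1)" by (metis power_Suc)
    then show ?thesis by simp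
  qed
  ultimately show ?thesis
    using pow_mult_pow_in_SG[OF assms(1,3,4)] PQ(1) by simp
qed

text \<open>With M = p^(s-1) (p-1) and N = p^(r-s) M, level \<open>s > 0\<close> has p^(r-s) shapes
  with M^2 pairs each, that is N M pairs. Adding the N pairs of level 0, the sum telescopes.\<close>

lemma card_tableau_pairs:
  assumes "odd p" "p \<ge> 3"
  shows "card (tableau_pairs p r) = p ^ (r - 1) * (p - 1) * p ^ (r - 1)"
proof -
  define N where "N = p ^ (r - 1) * (p - 1)"
  define X where "X s = (\<Union>h\<in>W_shapes p r s. SYT_W p r s h \<times> SYT_W p r s h)" for s
  have card_W0: "card (W_shapes p r 0) = N"
  proof -
    have "W_shapes p r 0 = hook N ` {..<N}" by (auto simp: W_shapes_def N_def)
    then show ?thesis by (simp add: card_image inj_on_def hook_inject)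
  qed
  have "finite (X s) \<and> card (X s) = (if s = 0 then N else N * (p ^ (s - 1) * (p - 1)))"
    if s: "s \<le> r - 1" for s
  proof (cases "s = 0")
    case True
    have "X 0 = (\<lambda>h. ([h], [h])) ` W_shapes p r 0" by (auto simp: X_def SYT_W_def)
    moreover have "finite (W_shapes p r 0)"
      using card_W0 assms by (intro card_ge_0_finite) (simp add: N_def)
    ultimately show ?thesis using True card_W0 by (simp add: card_image inj_on_def)
  next
    case False
    then have "0 < s" by simp
    define M where "M = p ^ (s - 1) * (p - 1)"
    have "M > 0" using assms by (simp add: M_def)
    have card: "card (SYT_W p r s h) = M" "finite (SYT_W p r s h)" if "h \<in> W_shapes p r s" for h
      using card_SYT_W[OF assms \<open>0 < s\<close> s that] \<open>M > 0\<close>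
      by (auto simp: M_def intro!: card_ge_0_finite)
    have W: "card (W_shapes p r s) = p ^ (r - s)"
      using card_W_shapes[OF assms(2) \<open>0 < s\<close> s] .
    then have fin: "finite (W_shapes p r s)" using assms by (intro card_ge_0_finite) simp
    have "card (X s) = (\<Sum>h\<in>W_shapes p r s. card (SYT_W p r s h \<times> SYT_W p r s h))"
      unfolding X_def
    proof (rule card_UN_disjoint[OF fin])
      show "\<forall>h\<in>W_shapes p r s. finite (SYT_W p r s h \<times> SYT_W p r s h)" using card by simp
      show "\<forall>h\<in>W_shapes p r s. \<forall>h'\<in>W_shapes p r s. h \<noteq> h' \<longrightarrow>
          SYT_W p r s h \<times> SYT_W p r s h \<inter> SYT_W p r s h' \<times> SYT_W p r s h' = {}"
        using length_SYT_W by blast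
    qed
    also have "\<dots> = p ^ (r - s) * (M * M)"
      using card W by (simp add: card_cartesian_product)
    also have "\<dots> = N * M"
    proof -
      have "r - 1 = (r - s) + (s - 1)" using s \<open>0 < s\<close> by simp
      then have "N = p ^ (r - s) * M" unfolding N_def M_def by (simp only: power_add mult_ac)
      then show ?thesis by simp
    qed
    finally show ?thesis
      using \<open>0 < s\<close> fin card by (simp add: M_def X_def)
  qed
  note X = this
  have "card (tableau_pairs p r) = (\<Sum>s\<in>{0..r - 1}. card (X s))"
    unfolding tableau_pairs_def X_def[symmetric]
  proof (rule card_UN_disjoint)
    show "\<forall>s\<in>{0..r - 1}. finite (X s)" using X by simp
    \<comment> \<open>The chain length reveals the level, so different levels share no
      pairs.\<close>
    have len: "length (fst x) = 2 * s + 1" if "x \<in> X s" for x s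
      using that length_SYT_W by (auto simp: X_def)
    have "s = s'" if "x \<in> X s" "x \<in> X s'" for x s s'
      using len[OF that(1)] len[OF that(2)] by simp
    then show "\<forall>s\<in>{0..r - 1}. \<forall>s'\<in>{0..r - 1}. s \<noteq> s' \<longrightarrow> X s \<inter> X s' = {}"
      by blast
  qed simp
  also have "\<dots> = (\<Sum>s\<in>{0..r - 1}. if s = 0 then N else N * (p ^ (s - 1) * (p - 1)))"
    using X by (intro sum.cong) auto
  also have "\<dots> = N * p ^ (r - 1)"
  proof -
    have "(\<Sum>s\<in>{0..n}. if s = 0 then N else N * (p ^ (s - 1) * (p - 1))) = N * p ^ n" for n
    proof (induction n)
      case (Suc n)
      have "p = Suc (p - 1)" using assms by simp
      then have "N * p ^ n + N * (p ^ n * (p - 1)) = N * p ^ Suc n"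
        by (metis distrib_left mult.commute mult_Suc power_Suc)
      then show ?case using Suc by simp
    qed simp
    then show ?thesis .
  qed
  finally show ?thesis by (simp add: N_def)
qed

theorem theorem3p7:
  fixes p r t :: nat
    and G :: "('a, 'b) monoid_scheme"
    and g \<tau> :: 'a
    and jmap :: "nat \<Rightarrow> nat"
  assumes "prime p" and "odd p" and "r \<ge> 1"
    and "is_G p r t G g \<tau>"
    and "bij_betw jmap {0..<p ^ (r - 1) * (p - 1)} {0..<p ^ (r - 1) * (p - 1)}"
  shows "bij_betw (h_map p r G g \<tau> jmap) (tableau_pairs p r) (SG p r G g \<tau>)"
proof -
  let ?h = "h_map p r G g \<tau> jmap"
  have p: "p \<ge> 3"
    using prime_ge_2_nat[OF assms(1)] assms(2) by (cases "p = 2") auto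
  have r: "0 < r" using assms(3) by simp
  have inj: "inj_on ?h (tableau_pairs p r)"
    using assms(5) by (intro h_map_inj_on[OF assms(1,2) r assms(4)]) (auto simp: bij_betw_def)
  moreover have "?h ` tableau_pairs p r = SG p r G g \<tau>"
  \<comment> \<open>Surjectivity by counting: the image lies in the finite set \<open>SG\<close> and
    is at least as large.\<close>
  proof (rule card_seteq[OF finite_SG])
    show "?h ` tableau_pairs p r \<subseteq> SG p r G g \<tau>"
      using h_map_in_SG[OF assms(1,2) r assms(4)] by blast
    show "card (SG p r G g \<tau>) \<le> card (?h ` tableau_pairs p r)"
      unfolding card_image[OF inj] card_tableau_pairs[OF assms(2) p] by (rule card_SG_le)
  qed
  ultimately show ?thesis by (simp add: bij_betw_def)
qed

end
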